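(* Let $\mathcal{C}$ be the unit circle centered at the origin of the $xy$-plane in $\mathbb{R}^3$, with constant density $\lambda>0$ and potential $V(\mathbf{r})=-\int_{\mathcal{C}}\frac{\lambda\,du}{\|\mathbf{r}-u\|}$. All circular solutions of $\ddot{\mathbf{r}}=-\nabla V(\mathbf{r})$ lie in the horizontal plane (the $xy$-plane). Moreover, a circular solution (in the horizontal plane) of radius $r$ is stable in $\mathbb{R}^3$ if and only if $r>r_0$.
   Context: $du$ denotes arc length on $\mathcal{C}$. In cylindrical coordinates $(r,\varphi,z)$, $r>0$, the equation $\ddot{\mathbf{r}}=-\nabla V(\mathbf{r})$ becomes $$\ddot r=\frac{K^2}{r^3}-\frac{\partial V}{\partial r}(r,z),\qquad \ddot z=-\frac{\partial V}{\partial z}(r,z),\qquad \dot\varphi=\frac{K}{r^2},$$ where $V(r,z)=V(r\cos\varphi,r\sin\varphi,z)$ and $K$ is the (constant) angular momentum about the $z$-axis. The canonical projection of a solution $\mathbf{r}(t)$ is $(r(t),z(t))$; with $K$ the angular momentum of $\mathbf{r}(t)$, it satisfies the system formed by the first two equations. A solution is circular if its canonical projection is an equilibrium position of the system formed by the first two equations (its radius is the constant value of $r$). A circular solution is stable (in $\mathbb{R}^3$) if its canonical projection is a (Lyapunov) stable equilibrium position of that system of the first two equations. The number $r_0$: let $V(r)=V(r,0)$ for $r>1$, and $U(r)=\frac{K^2}{2r^2}+V(r)$. There is a threshold $K_0>0$ such that $U$ has no critical points in $(1,\infty)$ when $|K|<K_0$, exactly one critical point when $|K|=K_0$, and exactly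 two when $|K|>K_0$. The number $r_0\in(1,2)$ is the unique critical point of $U$ for $|K|=K_0$; equivalently, $r_0$ is the unique critical point in $(1,\infty)$ of $g(r)=r^3\frac{d}{dr}V(r)$. *)

theory Defs
  imports "HOL-Analysis.Analysis"
begin

definition gradient :: "('a::real_inner \<Rightarrow> real) \<Rightarrow> 'a \<Rightarrow> 'a" where
  "gradient f x = (THE g. GDERIV f x :> g)"

text \<open>Phase curves (position \<open>q\<close>, velocity \<open>v\<close>) of the second-order system
  \<open>q'' = F q\<close> on the configuration space \<open>D\<close>.\<close>

definition motion_on ::
  "'a::real_normed_vector set \<Rightarrow> ('a \<Rightarrow> 'a) \<Rightarrow> real set \<Rightarrow> (real \<Rightarrow> 'a) \<Rightarrow> (real \<Rightarrow> 'a) \<Rightarrow> bool" where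
  "motion_on D F I q v \<longleftrightarrow>
    (\<forall>t\<in>I. q t \<in> D \<and> (q has_vector_derivative v t) (at t within I)
          \<and> (v has_vector_derivative F (q t)) (at t within I))"

definition equilibrium :: "'a::real_normed_vector set \<Rightarrow> ('a \<Rightarrow> 'a) \<Rightarrow> 'a \<Rightarrow> bool" where
  "equilibrium D F p \<longleftrightarrow> p \<in> D \<and> F p = 0"

text \<open>Lyapunov stability in phase space. All solutions on all intervals \<open>[0,T)\<close> are
  considered, not just those existing for all times, so a motion which leaves the
  \<open>\<epsilon>\<close>-neighbourhood and ceases to exist later violates stability. Solutions on \<open>[0,\<infinity>)\<close> are covered
  by their restrictions to \<open>[0,T)\<close>. For locally Lipschitz \<open>F\<close> and open \<open>D\<close> in finite dimension,
  global existence of the motions starting near a stable \<open>p\<close> follows by continuation.\<close>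

definition lyapunov_stable :: "'a::real_normed_vector set \<Rightarrow> ('a \<Rightarrow> 'a) \<Rightarrow> 'a \<Rightarrow> bool" where
  "lyapunov_stable D F p \<longleftrightarrow> equilibrium D F p \<and>
    (\<forall>\<epsilon>>0. \<exists>\<delta>>0. \<forall>T q v.
       motion_on D F {0..<T} q v \<and> dist (q 0, v 0) (p, 0) < \<delta> \<longrightarrow>
       (\<forall>t\<in>{0..<T}. dist (q t, v t) (p, 0) < \<epsilon>))"

definition arc_length_integral ::
  "(real \<Rightarrow> 'a::real_normed_vector) \<Rightarrow> real \<Rightarrow> real \<Rightarrow> ('a \<Rightarrow> real) \<Rightarrow> real" where
  "arc_length_integral \<gamma> a b f =
    integral {a..b} (\<lambda>t. f (\<gamma> t) * norm (vector_derivative \<gamma> (at t)))"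

definition circle_curve :: "real \<Rightarrow> real^3" where
  "circle_curve t = vector [cos t, sin t, 0]"

definition unit_circle :: "(real^3) set" where
  "unit_circle = {x. norm x = 1 \<and> x $ 3 = 0}"

definition potential :: "real \<Rightarrow> real^3 \<Rightarrow> real" where
  "potential \<rho> x = - arc_length_integral circle_curve 0 (2 * pi) (\<lambda>u. \<rho> / norm (x - u))"

definition newton_solution ::
  "real \<Rightarrow> real set \<Rightarrow> (real \<Rightarrow> real^3) \<Rightarrow> (real \<Rightarrow> real^3) \<Rightarrow> bool" where
  "newton_solution \<rho> I x v \<longleftrightarrow> open I \<and> is_interval I \<and> I \<noteq> {} \<and>
    motion_on (- unit_circle) (\<lambda>y. - gradient (potential \<rho>) y) I x v"

text \<open>The potential is invariant under rotations about the \<open>z\<close>-axis, so its value at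
  \<open>(r cos \<phi>, r sin \<phi>, z)\<close> does not depend on \<open>\<phi>\<close>; we take \<open>\<phi> = 0\<close>.\<close>

definition cyl_potential :: "real \<Rightarrow> real \<Rightarrow> real \<Rightarrow> real" where
  "cyl_potential \<rho> r z = potential \<rho> (vector [r, 0, z])"

definition canonical_projection :: "real^3 \<Rightarrow> real \<times> real" where
  "canonical_projection x = (sqrt ((x $ 1)\<^sup>2 + (x $ 2)\<^sup>2), x $ 3)"

definition angular_momentum :: "real^3 \<Rightarrow> real^3 \<Rightarrow> real" where
  "angular_momentum x v = x $ 1 * v $ 2 - x $ 2 * v $ 1"

definition reduced_domain :: "(real \<times> real) set" where
  "reduced_domain = {(r, z). r > 0 \<and> (r, z) \<noteq> (1, 0)}"

definition reduced_field :: "real \<Rightarrow> real \<Rightarrow> real \<times> real \<Rightarrow> real \<times> real" where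
  "reduced_field \<rho> K = (\<lambda>(r, z).
    (K\<^sup>2 / r ^ 3 - deriv (\<lambda>s. cyl_potential \<rho> s z) r,
     - deriv (\<lambda>s. cyl_potential \<rho> r s) z))"

definition circular_solution ::
  "real \<Rightarrow> real set \<Rightarrow> (real \<Rightarrow> real^3) \<Rightarrow> (real \<Rightarrow> real^3) \<Rightarrow> real \<Rightarrow> bool" where
  "circular_solution \<rho> I x v r \<longleftrightarrow> newton_solution \<rho> I x v \<and>
    (\<exists>K z. (\<forall>t\<in>I. angular_momentum (x t) (v t) = K \<and> canonical_projection (x t) = (r, z)) \<and>
           equilibrium reduced_domain (reduced_field \<rho> K) (r, z))"

definition stable_circular_solution ::
  "real \<Rightarrow> real set \<Rightarrow> (real \<Rightarrow> real^3) \<Rightarrow> (real \<Rightarrow> real^3) \<Rightarrow> real \<Rightarrow> bool" where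
  "stable_circular_solution \<rho> I x v r \<longleftrightarrow> newton_solution \<rho> I x v \<and>
    (\<exists>K z. (\<forall>t\<in>I. angular_momentum (x t) (v t) = K \<and> canonical_projection (x t) = (r, z)) \<and>
           lyapunov_stable reduced_domain (reduced_field \<rho> K) (r, z))"

definition eff_potential :: "real \<Rightarrow> real \<Rightarrow> real \<Rightarrow> real" where
  "eff_potential \<rho> K r = K\<^sup>2 / (2 * r\<^sup>2) + cyl_potential \<rho> r 0"

definition critical_radii :: "real \<Rightarrow> real \<Rightarrow> real set" where
  "critical_radii \<rho> K = {r. r > 1 \<and> (eff_potential \<rho> K has_real_derivative 0) (at r)}"

definition is_threshold :: "real \<Rightarrow> real \<Rightarrow> bool" where
  "is_threshold \<rho> K\<^sub>0 \<longleftrightarrow> K\<^sub>0 > 0 \<and>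
    (\<forall>K. (\<bar>K\<bar> < K\<^sub>0 \<longrightarrow> critical_radii \<rho> K = {}) \<and>
         (\<bar>K\<bar> = K\<^sub>0 \<longrightarrow> card (critical_radii \<rho> K) = 1) \<and>
         (\<bar>K\<bar> > K\<^sub>0 \<longrightarrow> card (critical_radii \<rho> K) = 2))"

definition threshold :: "real \<Rightarrow> real" where
  "threshold \<rho> = (THE K\<^sub>0. is_threshold \<rho> K\<^sub>0)"

definition critical_radius :: "real \<Rightarrow> real" where
  "critical_radius \<rho> = (THE r. r \<in> critical_radii \<rho> (threshold \<rho>))"

end

theory Submission
  imports Defs
begin

text \<open>Write \<open>W(r,z) = - \<rho> J(r,z)\<close> for the ring's potential in the half-plane, where \<open>J\<close> is the integral of
the inverse distance to the ring. The vertical force always points towards the plane of the ring,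
so an equilibrium of the reduced system has \<open>z = 0\<close>, and it is a point where the effective
potential \<open>U(r) = K\<^sup>2/(2 r\<^sup>2) + W(r,0)\<close> is critical, that is, where \<open>K\<^sup>2 = g(r)\<close> with
\<open>g(r) = r\<^sup>3 W\<^sub>r(r,0)\<close>. Everything then depends on the shape of \<open>g\<close>, because \<open>r\<^sup>3 U'(r) = g(r) - K\<^sup>2\<close>.

The shape of \<open>g\<close> comes from a change of variable. Let \<open>Q\<close> be the point of the ring at angle \<open>t\<close>,
seen from a point \<open>P\<close> of the plane at distance \<open>u < 1\<close> from the centre \<open>O\<close>. In the triangle \<open>OPQ\<close>
the law of sines suggests using \<open>\<theta> = t + \<alpha>\<close>, where \<open>\<alpha>\<close> is the angle at \<open>Q\<close> and
\<open>sin \<alpha> = u sin \<theta>\<close>. With this angle \<open>dt / |PQ|\<close> becomes \<open>d\<theta> / cos \<alpha>\<close>, and so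
\<open>J(u,0)\<close> is the integral of \<open>1 / sqrt (1 - u\<^sup>2 sin\<^sup>2 \<theta>)\<close> (\<open>ring_integral_inside\<close>). This increases
with \<open>u\<close>: inside the ring the force is directed outwards and no circular orbit exists. By inversion
\<open>J(r,0)\<close> is, for \<open>r > 1\<close>, the integral of \<open>1 / sqrt (r\<^sup>2 - sin\<^sup>2 \<theta>)\<close>, and therefore \<open>g / \<rho>\<close> is the
integral of \<open>r\<^sup>4 (r\<^sup>2 - sin\<^sup>2 \<theta>)\<^bsup>-3/2\<^esup>\<close>. Here every integrand is a convex function of \<open>r\<close>, while \<open>g\<close>
tends to infinity at both ends of \<open>(1, \<infinity>)\<close>; hence \<open>g\<close> decreases up to one point and increases after
it, and that point is \<open>r\<^sub>0\<close> (\<open>critical_radius_turning_point\<close>).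

Let \<open>p\<close> be the radius of a circular orbit. If \<open>p > r\<^sub>0\<close>, then \<open>g - K\<^sup>2\<close> changes sign at \<open>p\<close> from negative
to positive, so \<open>U\<close> has a strict local minimum at \<open>p\<close>. Leaving the plane only raises \<open>W\<close>, so the
energy of the reduced system has a strict local minimum at the equilibrium, which makes it stable
(\<open>circular_orbit_stable\<close>). If \<open>p \<le> r\<^sub>0\<close>, then \<open>g > K\<^sup>2\<close> on \<open>(1, p)\<close>, so \<open>U\<close> increases up to \<open>p\<close>: an
arbitrarily small inward push starts a motion in the plane that never slows down below its initial
speed and covers a fixed distance (\<open>circular_orbit_unstable\<close>). Since only the inner side of \<open>p\<close> is
used, this includes the degenerate radius \<open>p = r\<^sub>0\<close>.\<close>

section \<open>The potential of the ring and its gradient\<close>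

text \<open>The squared distance from the point \<open>(r, 0, z)\<close> to the point of the ring at angle \<open>t\<close>, written as a
sum of squares so that its positivity off the ring is visible.\<close>

definition ring_dist2 :: "real \<Rightarrow> real \<Rightarrow> real \<Rightarrow> real" where
  "ring_dist2 r z t = (r - cos t)\<^sup>2 + (sin t)\<^sup>2 + z\<^sup>2"

definition ring_integral :: "real \<Rightarrow> real \<Rightarrow> real" where
  "ring_integral r z = integral {0..2*pi} (\<lambda>t. 1 / sqrt (ring_dist2 r z t))"

text \<open>The next two integrals are the components of the attraction, per unit density: minus the partial
derivatives of \<open>ring_integral\<close>.\<close>

definition radial_pull :: "real \<Rightarrow> real \<Rightarrow> real" where
  "radial_pull r z = integral {0..2*pi} (\<lambda>t. (r - cos t) / sqrt (ring_dist2 r z t) ^ 3)"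

definition vertical_pull :: "real \<Rightarrow> real \<Rightarrow> real" where
  "vertical_pull r z = integral {0..2*pi} (\<lambda>t. z / sqrt (ring_dist2 r z t) ^ 3)"

lemma ring_dist2_pos:
  assumes "(r, z) \<in> reduced_domain"
  shows "ring_dist2 r z t > 0"
proof (rule ccontr)
  assume "\<not> ring_dist2 r z t > 0"
  then have "(r - cos t)\<^sup>2 + (sin t)\<^sup>2 + z\<^sup>2 \<le> 0"
    by (simp add: ring_dist2_def)
  then have "(r - cos t)\<^sup>2 = 0" "(sin t)\<^sup>2 = 0" "z\<^sup>2 = 0"
    using zero_le_power2[of "r - cos t"] zero_le_power2[of "sin t"] zero_le_power2[of z] by linarith+
  then have "r = cos t" "sin t = 0" "z = 0" by auto
  moreover from this have "r\<^sup>2 = 1" using sin_cos_squared_add[of t] by simp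
  ultimately show False
    using assms by (auto simp: reduced_domain_def power2_eq_1_iff)
qed

lemma circle_curve_has_vector_derivative:
  "(circle_curve has_vector_derivative vector [- sin t, cos t, 0]) (at t)"
proof -
  have eq: "vector [a, b, 0] = a *\<^sub>R axis 1 1 + b *\<^sub>R (axis 2 1 :: real^3)" for a b :: real
    by (auto simp: vec_eq_iff forall_3 axis_def)
  have "((\<lambda>t. cos t *\<^sub>R axis 1 1 + sin t *\<^sub>R (axis 2 1 :: real^3)) has_vector_derivative
      (- sin t) *\<^sub>R axis 1 1 + cos t *\<^sub>R axis 2 1) (at t)"
    by (auto intro!: derivative_eq_intros)
  then show ?thesis by (simp add: circle_curve_def[abs_def] eq)
qed

lemma cyl_potential_eq: "cyl_potential \<rho> r z = - \<rho> * ring_integral r z"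
proof -
  have speed: "norm (vector_derivative circle_curve (at t)) = 1" for t
    unfolding vector_derivative_at[OF circle_curve_has_vector_derivative]
    by (simp add: norm_eq_sqrt_inner inner_vec_def sum_3 flip: power2_eq_square)
  have dist: "norm (vector [r, 0, z] - circle_curve t) = sqrt (ring_dist2 r z t)" for t
    by (simp add: norm_eq_sqrt_inner inner_vec_def sum_3 circle_curve_def ring_dist2_def
        flip: power2_eq_square)
  show ?thesis
    unfolding cyl_potential_def potential_def arc_length_integral_def ring_integral_def speed dist
    by (simp add: divide_inverse flip: integral_mult_right)
qed

lemma continuous_on_ring_dist2 [continuous_intros]:
  fixes r z t :: "'a::t2_space \<Rightarrow> real"
  assumes "continuous_on S r" "continuous_on S z" "continuous_on S t"
  shows "continuous_on S (\<lambda>x. ring_dist2 (r x) (z x) (t x))"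
  unfolding ring_dist2_def
  by (intro continuous_intros assms)

lemma continuous_on_ring_integral:
  "continuous_on reduced_domain (\<lambda>(r, z). ring_integral r z)"
proof -
  have *: "ring_dist2 r z t \<noteq> 0" if "(r, z) \<in> reduced_domain" for r z t
    using ring_dist2_pos[OF that, of t] by simp
  have "continuous_on (reduced_domain \<times> cbox 0 (2*pi)) (\<lambda>(x, t). 1 / sqrt (ring_dist2 (fst x) (snd x) t))"
    unfolding case_prod_beta by (intro continuous_intros) (auto simp: *)
  from integral_continuous_on_param[OF this] show ?thesis
    by (simp add: ring_integral_def case_prod_beta)
qed

text \<open>Differentiating under the integral along a curve, rather than in each coordinate, covers both uses:
the partial derivatives (curves parallel to the axes) and the conservation of energy along a motion. The set \<open>S\<close> may be a half-open
interval, which is where motions live.\<close>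

lemma ring_integral_has_derivative_along:
  fixes r z r' z' :: "real \<Rightarrow> real"
  assumes S: "convex S" "\<tau> \<in> S"
    and dom: "\<And>\<sigma>. \<sigma> \<in> S \<Longrightarrow> (r \<sigma>, z \<sigma>) \<in> reduced_domain"
    and r: "\<And>\<sigma>. \<sigma> \<in> S \<Longrightarrow> (r has_real_derivative r' \<sigma>) (at \<sigma> within S)"
    and z: "\<And>\<sigma>. \<sigma> \<in> S \<Longrightarrow> (z has_real_derivative z' \<sigma>) (at \<sigma> within S)"
    and cont: "continuous_on S r'" "continuous_on S z'"
  shows "((\<lambda>\<sigma>. ring_integral (r \<sigma>) (z \<sigma>)) has_real_derivative
      - (r' \<tau> * radial_pull (r \<tau>) (z \<tau>) + z' \<tau> * vertical_pull (r \<tau>) (z \<tau>))) (at \<tau> within S)"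
proof -
  define d where "d = (\<lambda>\<sigma> t. ring_dist2 (r \<sigma>) (z \<sigma>) t)"
  define D where "D = (\<lambda>\<sigma> t. - (((r \<sigma> - cos t) * r' \<sigma> + z \<sigma> * z' \<sigma>) / sqrt (d \<sigma> t) ^ 3))"
  have dpos: "d \<sigma> t > 0" if "\<sigma> \<in> S" for \<sigma> t
    using ring_dist2_pos[OF dom[OF that]] by (simp add: d_def)
  have contr: "continuous_on S r" "continuous_on S z"
    using r z by (auto intro: DERIV_continuous_on)
  have cfst: "continuous_on (S \<times> A) (\<lambda>x. f (fst x))" if "continuous_on S f" for f :: "real \<Rightarrow> real" and A :: "real set"
    by (rule continuous_on_compose2[OF that continuous_on_fst[OF continuous_on_id]]) auto
  have "((\<lambda>\<sigma>. integral (cbox 0 (2*pi)) (\<lambda>t. 1 / sqrt (d \<sigma> t))) has_real_derivative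
      integral (cbox 0 (2*pi)) (D \<tau>)) (at \<tau> within S)"
  proof (rule leibniz_rule_field_derivative)
    fix \<sigma> t assume \<sigma>: "\<sigma> \<in> S"
    have dd: "((\<lambda>\<sigma>. d \<sigma> t) has_real_derivative 2 * ((r \<sigma> - cos t) * r' \<sigma> + z \<sigma> * z' \<sigma>)) (at \<sigma> within S)"
      unfolding d_def ring_dist2_def
      by (auto intro!: derivative_eq_intros r[OF \<sigma>] z[OF \<sigma>] simp: algebra_simps)
    have ds: "((\<lambda>\<sigma>. sqrt (d \<sigma> t)) has_real_derivative
        (inverse (sqrt (d \<sigma> t)) / 2) * (2 * ((r \<sigma> - cos t) * r' \<sigma> + z \<sigma> * z' \<sigma>))) (at \<sigma> within S)"
      by (rule DERIV_chain2[OF DERIV_real_sqrt[OF dpos[OF \<sigma>]] dd])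
    show "((\<lambda>\<sigma>. 1 / sqrt (d \<sigma> t)) has_real_derivative D \<sigma> t) (at \<sigma> within S)"
      using dpos[OF \<sigma>, of t]
      by (intro DERIV_cong[OF DERIV_divide[OF DERIV_const ds]])
        (auto simp: D_def divide_simps power3_eq_cube)
  next
    fix \<sigma> assume "\<sigma> \<in> S"
    with dpos[OF this] show "(\<lambda>t. 1 / sqrt (d \<sigma> t)) integrable_on cbox 0 (2*pi)"
      unfolding d_def
      by (intro integrable_continuous continuous_intros) (auto simp: less_le)
  next
    show "continuous_on (S \<times> cbox 0 (2*pi)) (\<lambda>(\<sigma>, t). D \<sigma> t)"
      using dpos unfolding D_def d_def case_prod_beta
      by (intro continuous_intros cfst cont contr) (auto simp: less_le)
  qed (use S in auto)
  moreover have "integral (cbox 0 (2*pi)) (D \<tau>) =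
      - (r' \<tau> * radial_pull (r \<tau>) (z \<tau>) + z' \<tau> * vertical_pull (r \<tau>) (z \<tau>))"
  proof -
    define f where "f = (\<lambda>t. (r \<tau> - cos t) / sqrt (d \<tau> t) ^ 3)"
    define h where "h = (\<lambda>t. z \<tau> / sqrt (d \<tau> t) ^ 3)"
    have i: "f integrable_on {0..2*pi}" "h integrable_on {0..2*pi}"
      using dpos[OF S(2)] unfolding d_def f_def h_def
      by (intro integrable_continuous_real continuous_intros; force simp: less_le)+
    have "D \<tau> = (\<lambda>t. - (r' \<tau> * f t + z' \<tau> * h t))"
      by (simp add: D_def f_def h_def add_divide_distrib mult.commute)
    moreover have "radial_pull (r \<tau>) (z \<tau>) = integral {0..2*pi} f"
      "vertical_pull (r \<tau>) (z \<tau>) = integral {0..2*pi} h"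
      by (simp_all add: radial_pull_def vertical_pull_def f_def h_def d_def)
    ultimately show ?thesis using i
      by (simp only: box_real integral_neg integral_add integrable_on_mult_right integral_mult_right)
  qed
  ultimately show ?thesis by (simp add: ring_integral_def d_def)
qed

lemma open_reduced_domain: "open reduced_domain"
proof -
  have "reduced_domain = ({0<..} \<times> UNIV) - {(1, 0)}"
    by (auto simp: reduced_domain_def)
  moreover have "open ({0<..} \<times> UNIV - {(1::real, 0::real)})"
    by (intro open_Diff open_Times open_greaterThan open_UNIV closed_singleton)
  ultimately show ?thesis by simp
qed

lemma ring_integral_has_partial_derivatives:
  assumes "(r, z) \<in> reduced_domain"
  shows "((\<lambda>s. ring_integral s z) has_real_derivative - radial_pull r z) (at r)"
    and "((\<lambda>s. ring_integral r s) has_real_derivative - vertical_pull r z) (at z)"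
proof -
  obtain e where e: "e > 0" "ball (r, z) e \<subseteq> reduced_domain"
    using open_reduced_domain assms by (auto simp: open_contains_ball)
  have r: "(s, z) \<in> reduced_domain" if "s \<in> ball r e" for s
    using e that by (force simp: dist_Pair_Pair)
  have z: "(r, s) \<in> reduced_domain" if "s \<in> ball z e" for s
    using e that by (force simp: dist_Pair_Pair)
  show "((\<lambda>s. ring_integral s z) has_real_derivative - radial_pull r z) (at r)"
    using ring_integral_has_derivative_along[of "ball r e" r "\<lambda>s. s" "\<lambda>s. z" "\<lambda>s. 1" "\<lambda>s. 0"] e r
    by (simp add: at_within_open[of _ "ball r e"])
  show "((\<lambda>s. ring_integral r s) has_real_derivative - vertical_pull r z) (at z)"
    using ring_integral_has_derivative_along[of "ball z e" z "\<lambda>s. r" "\<lambda>s. s" "\<lambda>s. 0" "\<lambda>s. 1"] e z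
    by (simp add: at_within_open[of _ "ball z e"])
qed

lemma reduced_field_eq:
  assumes "(r, z) \<in> reduced_domain"
  shows "reduced_field \<rho> K (r, z) = (K\<^sup>2 / r ^ 3 - \<rho> * radial_pull r z, - \<rho> * vertical_pull r z)"
proof -
  note partial = ring_integral_has_partial_derivatives[OF assms]
  have "((\<lambda>s. - \<rho> * ring_integral s z) has_real_derivative \<rho> * radial_pull r z) (at r)"
    using DERIV_cmult[OF partial(1), of "- \<rho>"] by simp
  moreover have "((\<lambda>s. - \<rho> * ring_integral r s) has_real_derivative \<rho> * vertical_pull r z) (at z)"
    using DERIV_cmult[OF partial(2), of "- \<rho>"] by simp
  ultimately show ?thesis
    by (simp only: reduced_field_def cyl_potential_eq[abs_def] DERIV_imp_deriv case_prod_conv) simp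
qed

section \<open>The in-plane potential as an elliptic integral\<close>

lemma integral_pos_real:
  fixes f :: "real \<Rightarrow> real"
  assumes "continuous_on {a..b} f" "a < b" "\<And>x. x \<in> {a..b} \<Longrightarrow> 0 \<le> f x" "c \<in> {a..b}" "f c > 0"
  shows "integral {a..b} f > 0"
proof -
  have "integral {a..b} f \<ge> 0"
    using assms by (intro integral_nonneg integrable_continuous_real) auto
  moreover have "integral {a..b} f \<noteq> 0"
    using integral_eq_0_iff[OF assms(1-3)] assms(4,5) by force
  ultimately show ?thesis by linarith
qed

text \<open>The substitution \<open>t = \<theta> - arcsin (u sin \<theta>)\<close> (a Landen transformation). With
\<open>w = sqrt (1 - u\<^sup>2 sin\<^sup>2 \<theta>)\<close> the distance to the ring becomes \<open>w - u cos \<theta>\<close>, and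
\<open>dt/d\<theta> = (w - u cos \<theta>) / w\<close>, so the distance cancels and \<open>1 / w\<close> remains.\<close>

lemma ring_integral_inside:
  assumes "0 < u" "u < 1"
  shows "ring_integral u 0 = integral {0..2*pi} (\<lambda>\<theta>. 1 / sqrt (1 - u\<^sup>2 * (sin \<theta>)\<^sup>2))"
proof -
  define f where "f = (\<lambda>t. 1 / sqrt (ring_dist2 u 0 t))"
  define g where "g = (\<lambda>\<theta>. \<theta> - arcsin (u * sin \<theta>))"
  define w where "w = (\<lambda>\<theta>. sqrt (1 - (u * sin \<theta>)\<^sup>2))"
  have us: "\<bar>u * sin \<theta>\<bar> < 1" for \<theta>
  proof -
    have "u * \<bar>sin \<theta>\<bar> \<le> u * 1" using assms by (intro mult_left_mono) auto
    then show ?thesis using assms unfolding abs_mult abs_of_pos[OF assms(1)] by linarith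
  qed
  then have us': "- 1 < u * sin \<theta>" "u * sin \<theta> < 1" for \<theta>
    using us[of \<theta>] by (simp_all add: abs_less_iff)
  have w2: "(w \<theta>)\<^sup>2 = 1 - (u * sin \<theta>)\<^sup>2" and w: "w \<theta> > 0" for \<theta>
    using us[of \<theta>] by (simp_all add: w_def abs_square_less_1 less_imp_le)
  have cosw: "u * cos \<theta> < w \<theta>" for \<theta>
  proof (rule power2_less_imp_less)
    have "(u * cos \<theta>)\<^sup>2 + (u * sin \<theta>)\<^sup>2 = u\<^sup>2"
      unfolding power_mult_distrib distrib_left[symmetric] by simp
    moreover have "u\<^sup>2 < 1" using assms by (simp add: power_less_one_iff)
    ultimately show "(u * cos \<theta>)\<^sup>2 < (w \<theta>)\<^sup>2" by (simp add: w2)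
  qed (use w in \<open>simp add: less_imp_le\<close>)
  have dist: "ring_dist2 u 0 (g \<theta>) = (w \<theta> - u * cos \<theta>)\<^sup>2" for \<theta>
  proof -
    have c: "cos (g \<theta>) = cos \<theta> * w \<theta> + sin \<theta> * (u * sin \<theta>)"
      using us'[of \<theta>] by (simp add: g_def cos_diff cos_arcsin sin_arcsin w_def)
    have "ring_dist2 u 0 (g \<theta>) = u\<^sup>2 + 1 - 2 * u * cos (g \<theta>)"
      using sin_cos_squared_add[of "g \<theta>"] by (simp add: ring_dist2_def power2_eq_square algebra_simps)
    also have "\<dots> = u\<^sup>2 * ((sin \<theta>)\<^sup>2 + (cos \<theta>)\<^sup>2) + 1 - 2 * u * (cos \<theta> * w \<theta> + sin \<theta> * (u * sin \<theta>))"
      by (simp only: c sin_cos_squared_add)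
    also have "\<dots> = (1 - (u * sin \<theta>)\<^sup>2) - 2 * w \<theta> * (u * cos \<theta>) + (u * cos \<theta>)\<^sup>2"
      by algebra
    also have "\<dots> = (w \<theta> - u * cos \<theta>)\<^sup>2"
      by (simp add: w2[symmetric] power2_diff)
    finally show ?thesis .
  qed
  have "((\<lambda>\<theta>. (1 - u * cos \<theta> / w \<theta>) *\<^sub>R f (g \<theta>)) has_integral
      (integral {g 0..g (2*pi)} f)) {0..2*pi}"
  proof (rule has_integral_substitution_strong)
    show "g ` {0..2*pi} \<subseteq> {-pi..3*pi}"
    proof
      fix y assume "y \<in> g ` {0..2*pi}"
      then obtain \<theta> where "\<theta> \<in> {0..2*pi}" "y = g \<theta>" by blast
      then show "y \<in> {-pi..3*pi}"
        using arcsin_bounded[of "u * sin \<theta>"] us'[of \<theta>] pi_gt_zero by (auto simp: g_def)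
    qed
    have "(u, 0) \<in> reduced_domain" using assms by (auto simp: reduced_domain_def)
    then have "ring_dist2 u 0 t \<noteq> 0" for t
      using ring_dist2_pos[of u 0 t] by fastforce
    then show "continuous_on {-pi..3*pi} f"
      unfolding f_def by (intro continuous_intros) auto
    show "continuous_on {0..2*pi} g"
      unfolding g_def using us' by (intro continuous_intros continuous_on_arcsin ballI) (auto intro: less_imp_le)
    show "(g has_real_derivative (1 - u * cos \<theta> / w \<theta>)) (at \<theta> within {0..2*pi})" for \<theta>
      unfolding g_def w_def using us'[of \<theta>]
      by (auto intro!: derivative_eq_intros simp: divide_simps)
  qed (auto simp: g_def)
  moreover have "(1 - u * cos \<theta> / w \<theta>) *\<^sub>R f (g \<theta>) = 1 / sqrt (1 - u\<^sup>2 * (sin \<theta>)\<^sup>2)" for \<theta>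
  proof -
    have "f (g \<theta>) = 1 / (w \<theta> - u * cos \<theta>)"
      using cosw[of \<theta>] by (simp add: f_def dist)
    then show ?thesis
      using cosw[of \<theta>] w[of \<theta>] by (simp add: field_simps) (simp add: w_def power_mult_distrib)
  qed
  ultimately show ?thesis
    by (simp add: ring_integral_def f_def g_def integral_unique)
qed

text \<open>Inversion in the ring multiplies the distances to all points of the ring by the same factor:
\<open>|P - Q| = r |P' - Q|\<close> when \<open>P, P'\<close> lie on one ray at distances \<open>r\<close> and \<open>1/r\<close> from the centre.\<close>

lemma ring_integral_outside:
  assumes "r > 1"
  shows "ring_integral r 0 = integral {0..2*pi} (\<lambda>\<theta>. 1 / sqrt (r\<^sup>2 - (sin \<theta>)\<^sup>2))"
proof -
  have "ring_dist2 r 0 t = r\<^sup>2 * ring_dist2 (1/r) 0 t" for t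
  proof -
    have "ring_dist2 r 0 t = r\<^sup>2 + 1 - 2 * r * cos t" for r
      using sin_cos_squared_add[of t] by (simp add: ring_dist2_def power2_eq_square algebra_simps)
    from this[of r] this[of "1/r"] show ?thesis
      using assms by (simp add: distrib_left right_diff_distrib power2_eq_square)
  qed
  then have "ring_integral r 0 = (1/r) * ring_integral (1/r) 0"
    using assms unfolding ring_integral_def integral_mult_right[symmetric]
    by (simp add: real_sqrt_mult)
  also have "\<dots> = integral {0..2*pi} (\<lambda>\<theta>. (1/r) * (1 / sqrt (1 - (1/r)\<^sup>2 * (sin \<theta>)\<^sup>2)))"
    by (subst integral_mult_right, subst ring_integral_inside) (use assms in auto)
  also have "\<dots> = integral {0..2*pi} (\<lambda>\<theta>. 1 / sqrt (r\<^sup>2 - (sin \<theta>)\<^sup>2))"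
  proof (rule integral_cong)
    fix \<theta>
    have "r * sqrt (1 - (1/r)\<^sup>2 * (sin \<theta>)\<^sup>2) = sqrt (r\<^sup>2 * (1 - (1/r)\<^sup>2 * (sin \<theta>)\<^sup>2))"
      using assms by (simp add: real_sqrt_mult)
    also have "r\<^sup>2 * (1 - (1/r)\<^sup>2 * (sin \<theta>)\<^sup>2) = r\<^sup>2 - (sin \<theta>)\<^sup>2"
      using assms by (simp add: field_simps power_divide)
    finally show "(1/r) * (1 / sqrt (1 - (1/r)\<^sup>2 * (sin \<theta>)\<^sup>2)) = 1 / sqrt (r\<^sup>2 - (sin \<theta>)\<^sup>2)"
      by simp
  qed
  finally show ?thesis .
qed

text \<open>In the elliptic form each integrand increases with the radius, so inside the ring the
attraction points away from the centre. The original form of the integral has no such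
pointwise monotonicity.\<close>

lemma radial_pull_inside_neg:
  assumes "0 < r" "r < 1"
  shows "radial_pull r 0 < 0"
proof -
  define D where "D = (\<lambda>u \<theta>. u * (sin \<theta>)\<^sup>2 / sqrt (1 - u\<^sup>2 * (sin \<theta>)\<^sup>2) ^ 3)"
  have pos: "1 - u\<^sup>2 * (sin \<theta>)\<^sup>2 > 0" if "u \<in> {0<..<1}" for u \<theta> :: real
  proof -
    have "u\<^sup>2 * (sin \<theta>)\<^sup>2 \<le> u\<^sup>2 * 1" by (intro mult_left_mono) (auto simp: abs_square_le_1)
    moreover have "u\<^sup>2 < 1" using that by (simp add: power_less_one_iff)
    ultimately show ?thesis by linarith
  qed
  have contD: "continuous_on ({0<..<1} \<times> cbox 0 (2*pi)) (\<lambda>(u, \<theta>). D u \<theta>)"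
    unfolding D_def case_prod_beta using pos by (intro continuous_intros) (auto simp: less_le)
  have "((\<lambda>u. integral (cbox 0 (2*pi)) (\<lambda>\<theta>. 1 / sqrt (1 - u\<^sup>2 * (sin \<theta>)\<^sup>2))) has_real_derivative
      integral (cbox 0 (2*pi)) (D r)) (at r within {0<..<1})"
  proof (rule leibniz_rule_field_derivative[OF _ _ contD])
    fix u \<theta> :: real assume u: "u \<in> {0<..<1}"
    have "((\<lambda>u. 1 - u\<^sup>2 * (sin \<theta>)\<^sup>2) has_real_derivative - 2 * u * (sin \<theta>)\<^sup>2) (at u within {0<..<1})"
      by (auto intro!: derivative_eq_intros)
    note s = DERIV_chain2[OF DERIV_real_sqrt[OF pos[OF u]] this]
    show "((\<lambda>u. 1 / sqrt (1 - u\<^sup>2 * (sin \<theta>)\<^sup>2)) has_real_derivative D u \<theta>) (at u within {0<..<1})"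
      using pos[OF u, of \<theta>]
      by (intro DERIV_cong[OF DERIV_divide[OF DERIV_const s]]) (auto simp: D_def divide_simps power3_eq_cube)
  next
    fix u :: real assume "u \<in> {0<..<1}"
    from pos[OF this] show "(\<lambda>\<theta>. 1 / sqrt (1 - u\<^sup>2 * (sin \<theta>)\<^sup>2)) integrable_on cbox 0 (2*pi)"
      by (intro integrable_continuous continuous_intros) (auto simp: less_le)
  qed (use assms in auto)
  then have "((\<lambda>u. integral {0..2*pi} (\<lambda>\<theta>. 1 / sqrt (1 - u\<^sup>2 * (sin \<theta>)\<^sup>2))) has_real_derivative
      integral {0..2*pi} (D r)) (at r)"
    using assms by (simp add: at_within_open[of _ "{0<..<1}"])
  then have "((\<lambda>u. ring_integral u 0) has_real_derivative integral {0..2*pi} (D r)) (at r)"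
    by (rule has_field_derivative_transform_within_open[where S = "{0<..<1}"])
      (use assms ring_integral_inside in auto)
  moreover have "(r, 0) \<in> reduced_domain" using assms by (simp add: reduced_domain_def)
  ultimately have "- radial_pull r 0 = integral {0..2*pi} (D r)"
    using ring_integral_has_partial_derivatives(1) DERIV_unique by blast
  moreover have "integral {0..2*pi} (D r) > 0"
  proof (rule integral_pos_real[where c = "pi/2"])
    show "continuous_on {0..2*pi} (D r)"
      unfolding D_def using pos[of r] assms by (intro continuous_intros) (auto simp: less_le)
    show "0 \<le> D r \<theta>" for \<theta>
      unfolding D_def using assms pos[of r \<theta>] by (intro divide_nonneg_pos) auto
    show "D r (pi/2) > 0"
      unfolding D_def using assms pos[of r "pi/2"] by (intro divide_pos_pos) auto
  qed (use pi_gt_zero in auto)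
  ultimately show ?thesis by linarith
qed

lemma outside_pos:
  fixes r :: real
  assumes "r > 1"
  shows "r\<^sup>2 - (sin \<theta>)\<^sup>2 > 0"
proof -
  have "1 < r\<^sup>2" using assms by (simp add: one_less_power)
  then show ?thesis
    using sin_cos_squared_add[of \<theta>] zero_le_power2[of "cos \<theta>"] by linarith
qed

lemma radial_pull_outside:
  assumes "r > 1"
  shows "radial_pull r 0 = integral {0..2*pi} (\<lambda>\<theta>. r / sqrt (r\<^sup>2 - (sin \<theta>)\<^sup>2) ^ 3)"
proof -
  define D where "D = (\<lambda>r \<theta>. - (r / sqrt (r\<^sup>2 - (sin \<theta>)\<^sup>2) ^ 3))"
  have contD: "continuous_on ({1<..} \<times> cbox 0 (2*pi)) (\<lambda>(u, \<theta>). D u \<theta>)"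
    unfolding D_def case_prod_beta using outside_pos
    by (intro continuous_intros) (force simp: less_le)
  have "((\<lambda>u. integral (cbox 0 (2*pi)) (\<lambda>\<theta>. 1 / sqrt (u\<^sup>2 - (sin \<theta>)\<^sup>2))) has_real_derivative
      integral (cbox 0 (2*pi)) (D r)) (at r within {1<..})"
  proof (rule leibniz_rule_field_derivative[OF _ _ contD])
    fix u \<theta> :: real assume "u \<in> {1<..}"
    then have u: "u\<^sup>2 - (sin \<theta>)\<^sup>2 > 0" by (simp add: outside_pos del: diff_gt_0_iff_gt)
    have "((\<lambda>u. u\<^sup>2 - (sin \<theta>)\<^sup>2) has_real_derivative 2 * u) (at u within {1<..})"
      by (auto intro!: derivative_eq_intros)
    note s = DERIV_chain2[OF DERIV_real_sqrt[OF u] this]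
    show "((\<lambda>u. 1 / sqrt (u\<^sup>2 - (sin \<theta>)\<^sup>2)) has_real_derivative D u \<theta>) (at u within {1<..})"
      using u by (intro DERIV_cong[OF DERIV_divide[OF DERIV_const s]]) (auto simp: D_def divide_simps power3_eq_cube)
  next
    fix u :: real assume "u \<in> {1<..}"
    then show "(\<lambda>\<theta>. 1 / sqrt (u\<^sup>2 - (sin \<theta>)\<^sup>2)) integrable_on cbox 0 (2*pi)"
      using outside_pos[of u]
      by (intro integrable_continuous continuous_intros) (force simp: less_le)
  qed (use assms in auto)
  then have "((\<lambda>u. integral {0..2*pi} (\<lambda>\<theta>. 1 / sqrt (u\<^sup>2 - (sin \<theta>)\<^sup>2))) has_real_derivative
      integral {0..2*pi} (D r)) (at r)"
    using assms by (simp add: at_within_open[of _ "{1<..}"])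
  then have "((\<lambda>u. ring_integral u 0) has_real_derivative integral {0..2*pi} (D r)) (at r)"
    by (rule has_field_derivative_transform_within_open[where S = "{1<..}"])
      (use assms ring_integral_outside in auto)
  moreover have "(r, 0) \<in> reduced_domain" using assms by (simp add: reduced_domain_def)
  ultimately have "- radial_pull r 0 = integral {0..2*pi} (D r)"
    using ring_integral_has_partial_derivatives(1) DERIV_unique by blast
  then show ?thesis by (simp add: D_def)
qed

section \<open>The angular momentum of circular orbits\<close>

text \<open>Balance of centrifugal force and attraction at radius \<open>r\<close> reads \<open>K\<^sup>2 = \<rho> * orbit_momentum2 r\<close>, so this
is the function \<open>g\<close> that characterises \<open>r\<^sub>0\<close>, per unit density.\<close>

definition orbit_momentum2 :: "real \<Rightarrow> real" where
  "orbit_momentum2 r = r ^ 3 * radial_pull r 0"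

definition orbit_momentum2_deriv :: "real \<Rightarrow> real" where
  "orbit_momentum2_deriv r =
    integral {0..2*pi} (\<lambda>\<theta>. 4 * r ^ 3 / sqrt (r\<^sup>2 - (sin \<theta>)\<^sup>2) ^ 3 - 3 * r ^ 5 / sqrt (r\<^sup>2 - (sin \<theta>)\<^sup>2) ^ 5)"

lemma orbit_momentum2_eq:
  assumes "r > 1"
  shows "orbit_momentum2 r = integral {0..2*pi} (\<lambda>\<theta>. r ^ 4 / sqrt (r\<^sup>2 - (sin \<theta>)\<^sup>2) ^ 3)"
  unfolding orbit_momentum2_def radial_pull_outside[OF assms] integral_mult_right[symmetric]
  by (rule integral_cong) (simp add: power3_eq_cube power4_eq_xxxx)

lemma orbit_momentum2_integrand_continuous:
  assumes "r > 1"
  shows "continuous_on S (\<lambda>\<theta>. r ^ n / sqrt (r\<^sup>2 - (sin \<theta>)\<^sup>2) ^ m)"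
proof -
  have "sqrt (r\<^sup>2 - (sin \<theta>)\<^sup>2) ^ m \<noteq> 0" for \<theta>
    using outside_pos[OF assms, of \<theta>] by simp
  then show ?thesis by (intro continuous_intros) auto
qed

lemma orbit_momentum2_has_derivative:
  assumes "r > 1"
  shows "(orbit_momentum2 has_real_derivative orbit_momentum2_deriv r) (at r)"
proof -
  define D where "D = (\<lambda>r \<theta>. 4 * r ^ 3 / sqrt (r\<^sup>2 - (sin \<theta>)\<^sup>2) ^ 3 - 3 * r ^ 5 / sqrt (r\<^sup>2 - (sin \<theta>)\<^sup>2) ^ 5)"
  have contD: "continuous_on ({1<..} \<times> cbox 0 (2*pi)) (\<lambda>(u, \<theta>). D u \<theta>)"
    unfolding D_def case_prod_beta using outside_pos
    by (intro continuous_intros) (force simp: less_le)+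
  have "((\<lambda>u. integral (cbox 0 (2*pi)) (\<lambda>\<theta>. u ^ 4 / sqrt (u\<^sup>2 - (sin \<theta>)\<^sup>2) ^ 3)) has_real_derivative
      integral (cbox 0 (2*pi)) (D r)) (at r within {1<..})"
  proof (rule leibniz_rule_field_derivative[OF _ _ contD])
    fix u \<theta> :: real assume "u \<in> {1<..}"
    then have u: "u\<^sup>2 - (sin \<theta>)\<^sup>2 > 0" by (simp add: outside_pos del: diff_gt_0_iff_gt)
    have "((\<lambda>u. u\<^sup>2 - (sin \<theta>)\<^sup>2) has_real_derivative 2 * u) (at u within {1<..})"
      by (auto intro!: derivative_eq_intros)
    note s = DERIV_chain2[OF DERIV_real_sqrt[OF u] this]
    define q where "q = sqrt (u\<^sup>2 - (sin \<theta>)\<^sup>2)"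
    have q: "q > 0" using u by (simp add: q_def)
    show "((\<lambda>u. u ^ 4 / sqrt (u\<^sup>2 - (sin \<theta>)\<^sup>2) ^ 3) has_real_derivative D u \<theta>) (at u within {1<..})"
      unfolding D_def
      by (rule DERIV_cong[OF DERIV_divide[OF DERIV_power[OF DERIV_ident] DERIV_power[OF s]]];
          unfold q_def[symmetric]; use q in \<open>simp add: divide_simps power_numeral_reduce algebra_simps\<close>)
  next
    fix u :: real assume "u \<in> {1<..}"
    then show "(\<lambda>\<theta>. u ^ 4 / sqrt (u\<^sup>2 - (sin \<theta>)\<^sup>2) ^ 3) integrable_on cbox 0 (2*pi)"
      by (intro integrable_continuous orbit_momentum2_integrand_continuous) auto
  qed (use assms in auto)
  then have "((\<lambda>u. integral {0..2*pi} (\<lambda>\<theta>. u ^ 4 / sqrt (u\<^sup>2 - (sin \<theta>)\<^sup>2) ^ 3)) has_real_derivative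
      orbit_momentum2_deriv r) (at r)"
    using assms by (simp add: at_within_open[of _ "{1<..}"] orbit_momentum2_deriv_def D_def)
  then show ?thesis
    by (rule has_field_derivative_transform_within_open[where S = "{1<..}"])
      (use assms orbit_momentum2_eq in auto)
qed

text \<open>Convexity of \<open>orbit_momentum2\<close>: with \<open>s = sin \<theta>\<close> the second derivative of its integrand is
\<open>3 r\<^sup>2 s\<^sup>2 (r\<^sup>2 + 4 s\<^sup>2) (r\<^sup>2 - s\<^sup>2)\<^bsup>-7/2\<^esup>\<close>, which is nonnegative, and positive at \<open>\<theta> = \<pi>/2\<close>.\<close>

lemma orbit_momentum2_deriv_strict_mono:
  assumes "1 < r" "r < s"
  shows "orbit_momentum2_deriv r < orbit_momentum2_deriv s"
proof -
  define k where "k = (\<lambda>r \<theta>. 4 * r ^ 3 / sqrt (r\<^sup>2 - (sin \<theta>)\<^sup>2) ^ 3 - 3 * r ^ 5 / sqrt (r\<^sup>2 - (sin \<theta>)\<^sup>2) ^ 5)"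
  define k' where "k' = (\<lambda>r \<theta>. 3 * r\<^sup>2 * (sin \<theta>)\<^sup>2 * (r\<^sup>2 + 4 * (sin \<theta>)\<^sup>2) / sqrt (r\<^sup>2 - (sin \<theta>)\<^sup>2) ^ 7)"
  have deriv: "((\<lambda>r. k r \<theta>) has_real_derivative k' u \<theta>) (at u)" if "u > 1" for u \<theta>
  proof -
    define q where "q = sqrt (u\<^sup>2 - (sin \<theta>)\<^sup>2)"
    have u: "u\<^sup>2 - (sin \<theta>)\<^sup>2 > 0" by (rule outside_pos[OF that])
    have q: "q > 0" using u by (simp add: q_def)
    have q2: "(sin \<theta>)\<^sup>2 = u\<^sup>2 - q\<^sup>2" using u by (simp add: q_def)
    have "((\<lambda>u. u\<^sup>2 - (sin \<theta>)\<^sup>2) has_real_derivative 2 * u) (at u)"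
      by (auto intro!: derivative_eq_intros)
    note s = DERIV_chain2[OF DERIV_real_sqrt[OF u] this]
    show ?thesis unfolding k_def k'_def
      by (rule DERIV_cong[OF DERIV_diff[OF
              DERIV_divide[OF DERIV_cmult[OF DERIV_power[OF DERIV_ident]] DERIV_power[OF s]]
              DERIV_divide[OF DERIV_cmult[OF DERIV_power[OF DERIV_ident]] DERIV_power[OF s]]]];
          unfold q_def[symmetric] q2; use q in \<open>simp add: divide_simps power_numeral_reduce algebra_simps\<close>)
  qed
  have k'_nonneg: "k' u \<theta> \<ge> 0" if "u > 1" for u \<theta>
    using outside_pos[OF that, of \<theta>] unfolding k'_def by (intro divide_nonneg_pos mult_nonneg_nonneg add_nonneg_nonneg) auto
  have k'_pos: "k' u (pi/2) > 0" if "u > 1" for u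
    using outside_pos[OF that, of "pi/2"] that unfolding k'_def by (intro divide_pos_pos mult_pos_pos add_pos_pos) auto
  have cont: "continuous_on {0..2*pi} (k u)" if "u > 1" for u
    unfolding k_def using outside_pos[OF that] by (intro continuous_intros) (force simp: less_le)+
  have "0 < integral {0..2*pi} (\<lambda>\<theta>. k s \<theta> - k r \<theta>)"
  proof (rule integral_pos_real[where c = "pi/2"])
    show "continuous_on {0..2*pi} (\<lambda>\<theta>. k s \<theta> - k r \<theta>)"
      using assms by (intro continuous_intros cont) auto
    show "0 \<le> k s \<theta> - k r \<theta>" for \<theta>
    proof -
      have "\<exists>d. ((\<lambda>u. k u \<theta>) has_real_derivative d) (at u) \<and> 0 \<le> d" if "r \<le> u" for u
        using deriv[of u \<theta>] k'_nonneg[of u \<theta>] that assms(1) by (intro exI[of _ "k' u \<theta>"]) auto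
      then have "k r \<theta> \<le> k s \<theta>"
        using assms by (intro DERIV_nonneg_imp_nondecreasing[of r s "\<lambda>u. k u \<theta>"]) auto
      then show ?thesis by simp
    qed
    have "\<exists>d. ((\<lambda>u. k u (pi/2)) has_real_derivative d) (at u) \<and> 0 < d" if "r \<le> u" for u
      using deriv[of u "pi/2"] k'_pos[of u] that assms(1) by (intro exI[of _ "k' u (pi/2)"]) auto
    then have "k r (pi/2) < k s (pi/2)"
      using assms by (intro DERIV_pos_imp_increasing[of r s "\<lambda>u. k u (pi/2)"]) auto
    then show "0 < k s (pi/2) - k r (pi/2)" by simp
  qed (use pi_gt_zero in auto)
  also have "\<dots> = integral {0..2*pi} (k s) - integral {0..2*pi} (k r)"
    using assms by (intro integral_diff integrable_continuous_real cont) auto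
  finally show ?thesis by (simp add: orbit_momentum2_deriv_def k_def)
qed

text \<open>The integrand is at least \<open>r\<close>, because \<open>sqrt (r\<^sup>2 - sin\<^sup>2 \<theta>) \<le> r\<close>. This gives both the positivity of
\<open>orbit_momentum2\<close> and its growth at infinity.\<close>

lemma orbit_momentum2_ge_linear:
  assumes "r > 1"
  shows "orbit_momentum2 r \<ge> 2 * pi * r"
proof -
  have "integral {0..2*pi} (\<lambda>\<theta>. r) \<le> orbit_momentum2 r"
    unfolding orbit_momentum2_eq[OF assms]
  proof (intro integral_le integrable_continuous_real orbit_momentum2_integrand_continuous assms)
    fix \<theta>
    define q where "q = sqrt (r\<^sup>2 - (sin \<theta>)\<^sup>2)"
    have q: "q > 0" "q \<le> r"
      using outside_pos[OF assms, of \<theta>] assms by (auto simp: q_def intro: real_le_lsqrt)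
    then have "r * q ^ 3 \<le> r * r ^ 3" using assms by (intro mult_left_mono power_mono) auto
    also have "r * r ^ 3 = r ^ 4" by (simp add: power3_eq_cube power4_eq_xxxx)
    finally show "r \<le> r ^ 4 / sqrt (r\<^sup>2 - (sin \<theta>)\<^sup>2) ^ 3"
      unfolding q_def[symmetric] using q by (simp add: pos_le_divide_eq)
  qed auto
  then show ?thesis by simp
qed

text \<open>Near \<open>\<theta> = \<pi>/2\<close> the denominator nearly vanishes. If \<open>r\<^sup>2 = 1 + \<eta>\<^sup>2\<close>, then
\<open>r\<^sup>2 - sin\<^sup>2 \<theta> = \<eta>\<^sup>2 + cos\<^sup>2 \<theta> \<le> 4 \<eta>\<^sup>2\<close> on an interval of length \<open>\<eta>\<close>, which contributes at least
\<open>\<eta> / (2 \<eta>)\<^sup>3 = 1 / (8 \<eta>\<^sup>2)\<close>.\<close>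

lemma orbit_momentum2_unbounded_near_ring:
  "\<exists>r. 1 < r \<and> r < 2 \<and> orbit_momentum2 r > M"
proof -
  define \<eta> where "\<eta> = min 1 (1 / (8 * (\<bar>M\<bar> + 1)))"
  define r where "r = sqrt (1 + \<eta>\<^sup>2)"
  have \<eta>: "0 < \<eta>" "\<eta> \<le> 1" "\<eta> \<le> 1 / (8 * (\<bar>M\<bar> + 1))" by (auto simp: \<eta>_def)
  have r2: "r\<^sup>2 = 1 + \<eta>\<^sup>2" by (simp add: r_def add_nonneg_nonneg)
  have r: "1 < r" using \<eta> by (simp add: r_def)
  have "\<eta>\<^sup>2 \<le> 1" using \<eta> by (simp add: power_le_one)
  then have "r < 2" unfolding r_def by (intro real_less_lsqrt) auto
  let ?f = "\<lambda>\<theta>. r ^ 4 / sqrt (r\<^sup>2 - (sin \<theta>)\<^sup>2) ^ 3"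
  have lower: "1 / (2 * \<eta>) ^ 3 \<le> ?f \<theta>" if "\<theta> \<in> {pi/2..pi/2+\<eta>}" for \<theta>
  proof -
    define q where "q = sqrt (r\<^sup>2 - (sin \<theta>)\<^sup>2)"
    have "\<bar>cos \<theta>\<bar> = \<bar>sin (\<theta> - pi/2)\<bar>" by (simp add: sin_diff)
    also have "\<dots> \<le> \<bar>\<theta> - pi/2\<bar>" by (rule abs_sin_x_le_abs_x)
    also have "\<dots> \<le> \<bar>\<eta>\<bar>" using that \<eta> by auto
    finally have "(cos \<theta>)\<^sup>2 \<le> \<eta>\<^sup>2" by (simp only: abs_le_square_iff)
    then have "r\<^sup>2 - (sin \<theta>)\<^sup>2 \<le> 4 * \<eta>\<^sup>2"
      using r2 sin_cos_squared_add[of \<theta>] zero_le_power2[of \<eta>] by linarith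
    then have "r\<^sup>2 - (sin \<theta>)\<^sup>2 \<le> (2 * \<eta>)\<^sup>2" by simp
    then have "q \<le> 2 * \<eta>" unfolding q_def using \<eta> by (intro real_le_lsqrt) auto
    moreover have "q > 0" using outside_pos[OF r] by (simp add: q_def)
    moreover have "1 \<le> r ^ 4" using r by (simp add: one_le_power)
    ultimately have "1 / (2 * \<eta>) ^ 3 \<le> r ^ 4 / q ^ 3"
      by (intro frac_le power_mono) auto
    then show ?thesis by (simp add: q_def)
  qed
  have "\<eta>\<^sup>2 \<le> \<eta>" using \<eta> by (simp add: power2_eq_square mult_left_le)
  also have "\<dots> \<le> 1 / (8 * (\<bar>M\<bar> + 1))" by (rule \<eta>)
  finally have "(\<bar>M\<bar> + 1) * (8 * \<eta>\<^sup>2) \<le> 1" by (simp add: field_simps)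
  then have "\<bar>M\<bar> + 1 \<le> 1 / (8 * \<eta>\<^sup>2)" using \<eta>(1) by (subst pos_le_divide_eq) auto
  then have "M < 1 / (8 * \<eta>\<^sup>2)" by linarith
  also have "\<dots> = integral {pi/2..pi/2+\<eta>} (\<lambda>\<theta>. 1 / (2 * \<eta>) ^ 3)"
    using \<eta>(1) by (simp add: power_numeral_reduce)
  also have "\<dots> \<le> integral {pi/2..pi/2+\<eta>} ?f"
    using lower by (intro integral_le integrable_continuous_real orbit_momentum2_integrand_continuous r) auto
  also have "\<dots> \<le> integral {0..2*pi} ?f"
  proof (intro integral_subset_le integrable_continuous_real orbit_momentum2_integrand_continuous r ballI)
    show "{pi/2..pi/2+\<eta>} \<subseteq> {0..2*pi}" using \<eta>(1,2) pi_ge_two by auto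
    show "0 \<le> ?f \<theta>" for \<theta> using outside_pos[OF r, of \<theta>] by (intro divide_nonneg_pos) auto
  qed
  also have "\<dots> = orbit_momentum2 r" by (simp add: orbit_momentum2_eq[OF r])
  finally show ?thesis using r \<open>r < 2\<close> by blast
qed

text \<open>The two higher values \<open>f l\<close> and \<open>f u\<close> force the minimum over \<open>[l, u]\<close> into the interior, where the
derivative vanishes; its monotonicity settles the sign on either side.\<close>

lemma unimodal_of_increasing_derivative:
  fixes f f' :: "real \<Rightarrow> real"
  assumes deriv: "\<And>x. x > a \<Longrightarrow> (f has_real_derivative f' x) (at x)"
    and mono: "\<And>x y. a < x \<Longrightarrow> x < y \<Longrightarrow> f' x < f' y"
    and higher: "a < l" "l < m" "m < u" "f l > f m" "f u > f m"
  obtains c where "a < c" "\<And>x y. a < x \<Longrightarrow> x < y \<Longrightarrow> y \<le> c \<Longrightarrow> f y < f x"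
    "\<And>x y. c \<le> x \<Longrightarrow> x < y \<Longrightarrow> f x < f y"
proof -
  have "continuous_on {l..u} f"
    using deriv higher by (intro continuous_at_imp_continuous_on ballI DERIV_isCont[OF deriv]) auto
  then obtain c where c: "c \<in> {l..u}" "\<And>x. x \<in> {l..u} \<Longrightarrow> f c \<le> f x"
    using continuous_attains_inf[of "{l..u}" f] higher by auto
  have "f c \<le> f m" using c higher by auto
  with higher c(1) have lcu: "l < c" "c < u" by (auto simp: less_le)
  have "f' c = 0"
  proof (rule DERIV_local_min)
    show "0 < min (c - l) (u - c)" using lcu by simp
    show "\<forall>y. \<bar>c - y\<bar> < min (c - l) (u - c) \<longrightarrow> f c \<le> f y"
      by (intro allI impI c(2)) (auto simp: abs_less_iff)
    show "(f has_real_derivative f' c) (at c)" using deriv lcu higher by simp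
  qed
  have neg: "f' x < 0" if "a < x" "x < c" for x
    using mono[of x c] that \<open>f' c = 0\<close> by simp
  have pos: "f' x > 0" if "c < x" for x
    using mono[of c x] that \<open>f' c = 0\<close> lcu higher by simp
  show ?thesis
  proof
    show "a < c" using lcu higher by simp
    show "f y < f x" if "a < x" "x < y" "y \<le> c" for x y
    proof (rule DERIV_neg_imp_decreasing_open[of x y f])
      show "\<exists>d. (f has_real_derivative d) (at t) \<and> d < 0" if "x < t" "t < y" for t
        using that \<open>a < x\<close> \<open>y \<le> c\<close> by (intro exI[of _ "f' t"] conjI deriv neg) auto
      show "continuous_on {x..y} f"
        using that by (intro continuous_at_imp_continuous_on ballI DERIV_isCont[OF deriv]) auto
    qed fact
    show "f x < f y" if "c \<le> x" "x < y" for x y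
    proof (rule DERIV_pos_imp_increasing_open[of x y f])
      show "\<exists>d. (f has_real_derivative d) (at t) \<and> 0 < d" if "x < t" "t < y" for t
        using that \<open>c \<le> x\<close> \<open>a < c\<close> by (intro exI[of _ "f' t"] conjI deriv pos) auto
      show "continuous_on {x..y} f"
        using that \<open>a < c\<close> by (intro continuous_at_imp_continuous_on ballI DERIV_isCont[OF deriv]) auto
    qed fact
  qed
qed

lemma orbit_momentum2_unimodal:
  obtains c where "1 < c" "\<And>r s. 1 < r \<Longrightarrow> r < s \<Longrightarrow> s \<le> c \<Longrightarrow> orbit_momentum2 s < orbit_momentum2 r"
    "\<And>r s. c \<le> r \<Longrightarrow> r < s \<Longrightarrow> orbit_momentum2 r < orbit_momentum2 s"
proof -
  obtain l where l: "1 < l" "l < 2" "orbit_momentum2 l > orbit_momentum2 2"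
    using orbit_momentum2_unbounded_near_ring by blast
  define u where "u = 3 + \<bar>orbit_momentum2 2\<bar>"
  have "1 * u \<le> (2 * pi) * u" using pi_ge_two by (intro mult_right_mono) (auto simp: u_def)
  also have "\<dots> \<le> orbit_momentum2 u" by (rule orbit_momentum2_ge_linear) (simp add: u_def)
  finally have u: "2 < u" "orbit_momentum2 u > orbit_momentum2 2" by (auto simp: u_def)
  show ?thesis
    by (rule unimodal_of_increasing_derivative[OF orbit_momentum2_has_derivative
          orbit_momentum2_deriv_strict_mono l(1,2) u(1) l(3) u(2)]) (auto intro: that)
qed

lemma eff_potential_has_derivative:
  assumes "r > 1"
  shows "(eff_potential \<rho> K has_real_derivative (\<rho> * orbit_momentum2 r - K\<^sup>2) / r ^ 3) (at r)"
proof -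
  have "(r, 0) \<in> reduced_domain" using assms by (simp add: reduced_domain_def)
  note ring = ring_integral_has_partial_derivatives(1)[OF this]
  have "((\<lambda>r. K\<^sup>2 / (2 * r\<^sup>2)) has_real_derivative - (K\<^sup>2 / r ^ 3)) (at r)"
    using assms by (auto intro!: derivative_eq_intros simp: divide_simps power_numeral_reduce)
  from DERIV_add[OF this DERIV_cmult[OF ring, of "- \<rho>"]] show ?thesis
    using assms by (simp add: eff_potential_def[abs_def] cyl_potential_eq orbit_momentum2_def diff_divide_distrib)
qed

lemma critical_radii_eq:
  assumes "\<rho> > 0"
  shows "critical_radii \<rho> K = {r. r > 1 \<and> orbit_momentum2 r = K\<^sup>2 / \<rho>}"
proof -
  have "(eff_potential \<rho> K has_real_derivative 0) (at r) \<longleftrightarrow> orbit_momentum2 r = K\<^sup>2 / \<rho>"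
    if "r > 1" for r
  proof -
    have "(eff_potential \<rho> K has_real_derivative 0) (at r) \<longleftrightarrow> (\<rho> * orbit_momentum2 r - K\<^sup>2) / r ^ 3 = 0"
      using eff_potential_has_derivative[OF that] DERIV_unique by metis
    then show ?thesis using that assms by (simp add: field_simps)
  qed
  then show ?thesis by (auto simp: critical_radii_def)
qed

text \<open>The minimum point \<open>c\<close> of \<open>orbit_momentum2\<close> is identified with \<open>critical_radius \<rho>\<close> by counting the radii
at which \<open>orbit_momentum2\<close> takes the value \<open>K\<^sup>2/\<rho>\<close>: none below the minimum value, one at it, and one
on each side of \<open>c\<close> above it. Hence \<open>sqrt (\<rho> * orbit_momentum2 c)\<close> is a threshold; the counts differ in
the three cases, so it is the only one.\<close>

lemma critical_radius_turning_point:
  assumes "\<rho> > 0"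
  shows "critical_radius \<rho> > 1"
    and "\<And>r s. 1 < r \<Longrightarrow> r < s \<Longrightarrow> s \<le> critical_radius \<rho> \<Longrightarrow> orbit_momentum2 s < orbit_momentum2 r"
    and "\<And>r s. critical_radius \<rho> \<le> r \<Longrightarrow> r < s \<Longrightarrow> orbit_momentum2 r < orbit_momentum2 s"
proof -
  let ?g = orbit_momentum2
  obtain c where c: "1 < c" and decr: "\<And>r s. 1 < r \<Longrightarrow> r < s \<Longrightarrow> s \<le> c \<Longrightarrow> ?g s < ?g r"
    and incr: "\<And>r s. c \<le> r \<Longrightarrow> r < s \<Longrightarrow> ?g r < ?g s"
    using orbit_momentum2_unimodal by blast
  have min: "?g c < ?g r" if "1 < r" "r \<noteq> c" for r
    using decr[of r c] incr[of c r] that by linarith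
  have gc: "?g c > 0"
    using orbit_momentum2_ge_linear[OF c] c pi_gt_zero mult_pos_pos[of "2*pi" c] by linarith
  have cont: "isCont ?g r" if "1 < r" for r
    using orbit_momentum2_has_derivative[OF that] by (rule DERIV_isCont)
  have two: "\<exists>r s. 1 < r \<and> r < c \<and> c < s \<and> {r. r > 1 \<and> ?g r = v} = {r, s}" if v: "v > ?g c" for v
  proof -
    obtain l where l: "1 < l" "?g l > max v (?g 2)" "l < 2"
      using orbit_momentum2_unbounded_near_ring[of "max v (?g 2)"] by blast
    \<comment> \<open>the bound on the value at \<open>2\<close> only serves to place \<open>l\<close> on the decreasing side\<close>
    have "l < c"
    proof (rule ccontr)
      assume "\<not> l < c"
      then have "?g l < ?g 2" using incr[of l 2] l by simp
      then show False using l by simp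
    qed
    then obtain r where r: "l \<le> r" "r \<le> c" "?g r = v"
      using IVT2[of ?g c v l] v l cont by force
    define u where "u = c + \<bar>v\<bar>"
    have "1 * u \<le> (2 * pi) * u" using pi_ge_two c by (intro mult_right_mono) (auto simp: u_def)
    also have "\<dots> \<le> ?g u" by (rule orbit_momentum2_ge_linear) (use c in \<open>simp add: u_def\<close>)
    finally have "v \<le> ?g u" "c \<le> u" using c by (auto simp: u_def)
    then obtain s where s: "c \<le> s" "s \<le> u" "?g s = v"
      using IVT[of ?g c v u] v c cont by force
    have rs: "1 < r" "r < c" "c < s" using r s l v by (auto simp: less_le)
    have "x = r \<or> x = s" if "1 < x" "?g x = v" for x
      using decr[of x r] decr[of r x] incr[of x s] incr[of s x] that r s rs
      by (cases "x \<le> c"; cases x r rule: linorder_cases; cases x s rule: linorder_cases) auto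
    with rs r s have "{r. r > 1 \<and> ?g r = v} = {r, s}" by auto
    with rs show ?thesis by blast
  qed
  define K0 where "K0 = sqrt (\<rho> * ?g c)"
  have K0: "K0 > 0" "K0\<^sup>2 / \<rho> = ?g c" using gc assms by (simp_all add: K0_def)
  have at_K0: "critical_radii \<rho> K = {c}" if "\<bar>K\<bar> = K0" for K
  proof -
    have "K\<^sup>2 / \<rho> = ?g c" using K0 that by (metis power2_abs)
    with c min show ?thesis by (force simp: critical_radii_eq[OF assms])
  qed
  have below: "critical_radii \<rho> K = {}" if "\<bar>K\<bar> < K0" for K
  proof -
    have "K\<^sup>2 < K0\<^sup>2" using that by (metis abs_ge_zero power2_abs power_strict_mono pos2)
    then have "K\<^sup>2 / \<rho> < ?g c" using assms K0(2) by (metis divide_strict_right_mono)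
    with min show ?thesis by (force simp: critical_radii_eq[OF assms])
  qed
  have above: "card (critical_radii \<rho> K) = 2" if "\<bar>K\<bar> > K0" for K
  proof -
    have "K0\<^sup>2 < K\<^sup>2" using that K0(1) by (metis less_imp_le power2_abs power_strict_mono pos2)
    then have "?g c < K\<^sup>2 / \<rho>" using assms K0(2) by (metis divide_strict_right_mono)
    from two[OF this] obtain r s where "r < c" "c < s" "critical_radii \<rho> K = {r, s}"
      unfolding critical_radii_eq[OF assms] by blast
    then show ?thesis by simp
  qed
  have "is_threshold \<rho> K0"
    using K0(1) at_K0 below above by (simp add: is_threshold_def)
  moreover have "K = K0" if "is_threshold \<rho> K" for K
  proof -
    have "K > 0" "card (critical_radii \<rho> K) = 1" using that by (simp_all add: is_threshold_def)
    then show ?thesis using below[of K] above[of K] by (cases K K0 rule: linorder_cases) auto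
  qed
  ultimately have "threshold \<rho> = K0" unfolding threshold_def by blast
  then have "critical_radius \<rho> = c" using at_K0[of K0] K0(1) by (simp add: critical_radius_def)
  with c decr incr show "critical_radius \<rho> > 1"
    and "\<And>r s. 1 < r \<Longrightarrow> r < s \<Longrightarrow> s \<le> critical_radius \<rho> \<Longrightarrow> ?g s < ?g r"
    and "\<And>r s. critical_radius \<rho> \<le> r \<Longrightarrow> r < s \<Longrightarrow> ?g r < ?g s"
    by auto
qed

section \<open>Criteria for stability and for escape\<close>

text \<open>The theorem of Lagrange and Dirichlet: a strict local minimum of a conserved quantity is stable. On a
small sphere around the equilibrium the quantity exceeds its central value by a fixed gap; a motion
whose initial value exceeds the central one by less than this gap can never meet the sphere.\<close>

lemma lyapunov_stable_of_first_integral: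
  fixes p :: "'a::euclidean_space" and H :: "'a \<times> 'a \<Rightarrow> real"
  assumes eq: "equilibrium D F p"
    and R: "R > 0"
    and cont: "continuous_on (cball (p, 0) R) H"
    and min: "\<And>x. x \<in> cball (p, 0) R \<Longrightarrow> x \<noteq> (p, 0) \<Longrightarrow> H (p, 0) < H x"
    and inv: "\<And>T q v t. motion_on D F {0..<T} q v \<Longrightarrow> t \<in> {0..<T} \<Longrightarrow> H (q t, v t) = H (q 0, v 0)"
  shows "lyapunov_stable D F p"
  unfolding lyapunov_stable_def
proof (intro conjI eq allI impI)
  fix \<epsilon> :: real assume "\<epsilon> > 0"
  define e where "e = min \<epsilon> R"
  have e: "0 < e" "e \<le> \<epsilon>" "e \<le> R" using \<open>\<epsilon> > 0\<close> R by (auto simp: e_def)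
  have sub: "sphere (p, 0) e \<subseteq> cball (p, 0::'a) R" using e by auto
  have "sphere (p, 0::'a) e \<noteq> {}" using e by simp
  then obtain w where w: "w \<in> sphere (p, 0) e" "\<And>x. x \<in> sphere (p, 0) e \<Longrightarrow> H w \<le> H x"
    using continuous_attains_inf[OF compact_sphere _ continuous_on_subset[OF cont sub]] by blast
  have "w \<noteq> (p, 0)" using w e by auto
  then have gap: "H (p, 0) < H w" using min w sub by blast
  obtain d where d: "d > 0"
    "\<And>x. x \<in> cball (p, 0) R \<Longrightarrow> dist x (p, 0) < d \<Longrightarrow> dist (H x) (H (p, 0)) < H w - H (p, 0)"
    using cont[unfolded continuous_on_iff, rule_format, of "(p, 0)" "H w - H (p, 0)"] gap R by auto
  show "\<exists>\<delta>>0. \<forall>T q v. motion_on D F {0..<T} q v \<and> dist (q 0, v 0) (p, 0) < \<delta> \<longrightarrow>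
      (\<forall>t\<in>{0..<T}. dist (q t, v t) (p, 0) < \<epsilon>)"
  proof (intro exI[of _ "min d e"] conjI allI impI ballI)
    show "min d e > 0" using d e by simp
  next
    fix T q v t
    assume a: "motion_on D F {0..<T} q v \<and> dist (q 0, v 0) (p, 0) < min d e" and t: "t \<in> {0..<T}"
    then have mo: "motion_on D F {0..<T} q v" and start: "dist (q 0, v 0) (p, 0) < min d e" by auto
    have "continuous_on {0..<T} q" "continuous_on {0..<T} v"
      using mo unfolding motion_on_def
      by (auto intro: continuous_on_vector_derivative[where f' = v]
          continuous_on_vector_derivative[where f' = "\<lambda>t. F (q t)"])
    then have "continuous_on {0..t} (\<lambda>s. dist (q s, v s) (p, 0))"
      using t by (intro continuous_intros) (auto elim: continuous_on_subset)
    moreover have "H (q 0, v 0) < H w"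
      using d(2)[of "(q 0, v 0)"] start e by (auto simp: dist_real_def dist_commute)
    have "dist (q s, v s) (p, 0) \<noteq> e" if "s \<in> {0..t}" for s
    proof
      assume "dist (q s, v s) (p, 0) = e"
      then have "H w \<le> H (q s, v s)" by (intro w(2)) (simp add: dist_commute)
      also have "\<dots> = H (q 0, v 0)" using that t by (intro inv[OF mo]) auto
      finally show False using \<open>H (q 0, v 0) < H w\<close> by simp
    qed
    ultimately have "dist (q t, v t) (p, 0) < e"
      using IVT'[of "\<lambda>s. dist (q s, v s) (p, 0)" 0 e t] start t by force
    then show "dist (q t, v t) (p, 0) < \<epsilon>" using e by simp
  qed
qed

text \<open>An explicit motion of \<open>y'' = - U'(y)\<close> with energy \<open>E\<close>, travelling from \<open>p\<close> to the left until it reaches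
\<open>c\<close>. Conservation of energy fixes the speed at each position, so the travel time \<open>\<tau>\<close> is an integral over
the position and the motion is the inverse function of \<open>\<tau>\<close>. Because \<open>U < E\<close> throughout, the integrand is
continuous and no turning point occurs. The interval \<open>[a, b]\<close> extends beyond \<open>[c, p]\<close> on both sides so
that two-sided derivatives exist at both ends of the time interval. The second-order equation is left
implicit: it follows by differentiating the velocity.\<close>

lemma conservative_motion_by_quadrature:
  fixes U U' :: "real \<Rightarrow> real"
  assumes "a < c" "c \<le> p" "p < b"
    and U: "\<And>s. s \<in> {a..b} \<Longrightarrow> (U has_real_derivative U' s) (at s)"
    and E: "\<And>s. s \<in> {a..b} \<Longrightarrow> U s < E"
  obtains T y where "0 \<le> T" "y 0 = p" "y T = c" "\<And>t. t \<in> {0..T} \<Longrightarrow> y t \<in> {c..p}"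
    "\<And>t. t \<in> {0..T} \<Longrightarrow> (y has_real_derivative - sqrt (2 * (E - U (y t)))) (at t)"
proof -
  define f where "f = (\<lambda>s. - (1 / sqrt (2 * (E - U s))))"
  define \<tau> where "\<tau> = (\<lambda>s. integral {a..s} f - integral {a..p} f)"
  have fneg: "f s < 0" if "s \<in> {a..b}" for s using E[OF that] by (simp add: f_def)
  have contU: "continuous_on {a..b} U"
    by (intro continuous_at_imp_continuous_on ballI DERIV_isCont[OF U])
  have contf: "continuous_on {a..b} f"
    unfolding f_def using E by (intro continuous_intros contU) force
  have \<tau>_deriv: "(\<tau> has_real_derivative f s) (at s)" if "s \<in> {a<..<b}" for s
  proof -
    have "((\<lambda>s. integral {a..s} f) has_real_derivative f s) (at s within {a..b})"
      using that by (intro integral_has_real_derivative contf) auto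
    then have "((\<lambda>s. integral {a..s} f) has_real_derivative f s) (at s)"
      using that by (simp add: at_within_Icc_at)
    then show ?thesis unfolding \<tau>_def by (auto intro!: derivative_eq_intros)
  qed
  have contt: "continuous_on {a<..<b} \<tau>"
    by (intro continuous_at_imp_continuous_on ballI DERIV_isCont[OF \<tau>_deriv])
  have \<tau>_decr: "\<tau> s > \<tau> s'" if "s \<in> {a<..<b}" "s' \<in> {a<..<b}" "s < s'" for s s'
  proof (rule DERIV_neg_imp_decreasing[of s s' \<tau>, OF that(3)])
    fix x assume "s \<le> x" "x \<le> s'"
    with that show "\<exists>d. (\<tau> has_real_derivative d) (at x) \<and> d < 0"
      by (intro exI[of _ "f x"] conjI \<tau>_deriv fneg) auto
  qed
  have inj: "inj_on \<tau> {a<..<b}"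
    by (rule linorder_inj_onI) (use \<tau>_decr in \<open>force+\<close>)
  define y where "y = the_inv_into {a<..<b} \<tau>"
  have y\<tau>: "y (\<tau> s) = s" if "s \<in> {a<..<b}" for s
    unfolding y_def by (rule the_inv_into_f_f[OF inj that])
  have \<tau>p: "\<tau> p = 0" by (simp add: \<tau>_def)
  have cpab: "{c..p} \<subseteq> {a<..<b}" using assms(1-3) by auto
  have onto: "\<exists>s\<in>{c..p}. \<tau> s = t" if "t \<in> {0..\<tau> c}" for t
    using IVT2'[of \<tau> p t c] that \<tau>p assms(2) continuous_on_subset[OF contt cpab] by auto
  have T: "0 \<le> \<tau> c"
    using \<tau>_decr[of c p] \<tau>p assms(1-3) by (cases "c = p") auto
  show ?thesis
  proof
    show "0 \<le> \<tau> c" by (rule T)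
    show "y 0 = p" using y\<tau>[of p] \<tau>p assms(1-3) by simp
    show "y (\<tau> c) = c" using y\<tau>[of c] assms(1-3) by simp
    fix t assume "t \<in> {0..\<tau> c}"
    then obtain s where s: "s \<in> {c..p}" "\<tau> s = t" using onto by blast
    then have s': "s \<in> {a<..<b}" using cpab by auto
    have yt: "y t = s" using y\<tau>[OF s'] s by simp
    then show "y t \<in> {c..p}" using s by simp
    have "(y has_derivative (\<lambda>h. h / f s)) (at (\<tau> s))"
    proof (rule has_derivative_inverse_strong[of "{a<..<b}" s \<tau> y "\<lambda>h. h * f s"])
      show "(\<tau> has_derivative (\<lambda>h. h * f s)) (at s)"
        using \<tau>_deriv[OF s'] by (simp add: has_field_derivative_def mult_commute_abs)
      show "(\<lambda>h. h * f s) \<circ> (\<lambda>h. h / f s) = id"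
        using fneg[of s] s' by auto
    qed (use s' contt y\<tau> in auto)
    then have "(y has_real_derivative 1 / f s) (at t)"
      unfolding has_field_derivative_def s(2) by (rule has_derivative_eq_rhs) auto
    then show "(y has_real_derivative - sqrt (2 * (E - U (y t)))) (at t)"
      by (simp add: f_def yt)
  qed
qed

section \<open>Circular orbits, their stability and instability\<close>

lemma vertical_pull_eq_0_iff:
  assumes "(r, z) \<in> reduced_domain"
  shows "vertical_pull r z = 0 \<longleftrightarrow> z = 0"
proof
  assume eq: "vertical_pull r z = 0"
  have pos: "ring_dist2 r z t > 0" for t by (rule ring_dist2_pos[OF assms])
  have "0 < integral {0..2*pi} (\<lambda>t. 1 / sqrt (ring_dist2 r z t) ^ 3)"
  proof (rule integral_pos_real[where c = 0])
    show "continuous_on {0..2*pi} (\<lambda>t. 1 / sqrt (ring_dist2 r z t) ^ 3)"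
      using pos by (intro continuous_intros) (auto simp: less_le)
  qed (use pos less_imp_le[OF pos] in simp_all)
  moreover have "vertical_pull r z = z * integral {0..2*pi} (\<lambda>t. 1 / sqrt (ring_dist2 r z t) ^ 3)"
    unfolding vertical_pull_def integral_mult_right[symmetric] by simp
  ultimately show "z = 0" using eq by auto
qed (simp add: vertical_pull_def)

lemma ring_integral_less_in_plane:
  assumes "r > 1" "z \<noteq> 0"
  shows "ring_integral r z < ring_integral r 0"
  unfolding ring_integral_def
proof (rule integral_less_real)
  have pos: "ring_dist2 r z t > 0" "ring_dist2 r 0 t > 0" for t
    using assms by (auto intro!: ring_dist2_pos simp: reduced_domain_def)
  then show "continuous_on {0..2*pi} (\<lambda>t. 1 / sqrt (ring_dist2 r z t))"
    "continuous_on {0..2*pi} (\<lambda>t. 1 / sqrt (ring_dist2 r 0 t))"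
    by (intro continuous_intros; force simp: less_le)+
  show "1 / sqrt (ring_dist2 r z t) < 1 / sqrt (ring_dist2 r 0 t)" for t
    using pos[of t] assms by (intro divide_strict_left_mono mult_pos_pos) (auto simp: ring_dist2_def)
  show "{0<..<2*pi} \<noteq> {}"
    using pi_gt_zero by (simp only: greaterThanLessThan_empty_iff)
qed

lemma reduced_equilibrium:
  assumes "\<rho> > 0" "equilibrium reduced_domain (reduced_field \<rho> K) (r, z)"
  shows "z = 0" "r > 1" "\<rho> * orbit_momentum2 r = K\<^sup>2"
proof -
  have dom: "(r, z) \<in> reduced_domain" and
    eq: "K\<^sup>2 / r ^ 3 = \<rho> * radial_pull r z" "\<rho> * vertical_pull r z = 0"
    using assms(2) by (auto simp: equilibrium_def reduced_field_eq zero_prod_def)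
  show z: "z = 0" using eq assms(1) vertical_pull_eq_0_iff[OF dom] by simp
  have r: "r > 0" "r \<noteq> 1" using dom z by (auto simp: reduced_domain_def)
  show "r > 1"
  proof (rule ccontr)
    assume "\<not> r > 1"
    then have "radial_pull r 0 < 0" using r by (intro radial_pull_inside_neg) auto
    then have "K\<^sup>2 / r ^ 3 < 0" using eq z assms(1) by (simp add: mult_pos_neg)
    moreover have "K\<^sup>2 / r ^ 3 \<ge> 0" using r by simp
    ultimately show False by linarith
  qed
  show "\<rho> * orbit_momentum2 r = K\<^sup>2"
    using eq z r by (simp add: orbit_momentum2_def field_simps)
qed

definition reduced_energy :: "real \<Rightarrow> real \<Rightarrow> (real \<times> real) \<times> (real \<times> real) \<Rightarrow> real" where
  "reduced_energy \<rho> K = (\<lambda>((r, z), (a, b)). (a\<^sup>2 + b\<^sup>2) / 2 + K\<^sup>2 / (2 * r\<^sup>2) - \<rho> * ring_integral r z)"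

lemma reduced_energy_conserved:
  assumes mo: "motion_on reduced_domain (reduced_field \<rho> K) {0..<T} q v" and t: "t \<in> {0..<T}"
  shows "reduced_energy \<rho> K (q t, v t) = reduced_energy \<rho> K (q 0, v 0)"
proof -
  let ?I = "{0..<T}"
  define r z a b where "r = (\<lambda>t. fst (q t))" and "z = (\<lambda>t. snd (q t))"
    and "a = (\<lambda>t. fst (v t))" and "b = (\<lambda>t. snd (v t))"
  have fst_deriv: "((\<lambda>t. fst (f t)) has_real_derivative fst f') (at t within ?I)"
    and snd_deriv: "((\<lambda>t. snd (f t)) has_real_derivative snd f') (at t within ?I)"
    if "(f has_vector_derivative f') (at t within ?I)" for f :: "real \<Rightarrow> real \<times> real" and f' t
    using bounded_linear.has_vector_derivative[OF bounded_linear_fst that]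
      bounded_linear.has_vector_derivative[OF bounded_linear_snd that]
    by (simp_all add: has_real_derivative_iff_has_vector_derivative)
  have dom: "(r t, z t) \<in> reduced_domain" if "t \<in> ?I" for t
    using mo that by (auto simp: motion_on_def r_def z_def)
  have rz: "(r has_real_derivative a t) (at t within ?I)" "(z has_real_derivative b t) (at t within ?I)"
    if "t \<in> ?I" for t
    using fst_deriv[of q "v t" t] snd_deriv[of q "v t" t] mo that
    by (simp_all add: motion_on_def r_def z_def a_def b_def)
  have ab: "(a has_real_derivative K\<^sup>2 / r t ^ 3 - \<rho> * radial_pull (r t) (z t)) (at t within ?I)"
    "(b has_real_derivative - \<rho> * vertical_pull (r t) (z t)) (at t within ?I)" if "t \<in> ?I" for t
  proof -
    have "reduced_field \<rho> K (q t) = (K\<^sup>2 / r t ^ 3 - \<rho> * radial_pull (r t) (z t), - \<rho> * vertical_pull (r t) (z t))"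
      using reduced_field_eq[OF dom[OF that]] by (simp add: r_def z_def)
    then show "(a has_real_derivative K\<^sup>2 / r t ^ 3 - \<rho> * radial_pull (r t) (z t)) (at t within ?I)"
      "(b has_real_derivative - \<rho> * vertical_pull (r t) (z t)) (at t within ?I)"
      using fst_deriv[of v "reduced_field \<rho> K (q t)" t] snd_deriv[of v "reduced_field \<rho> K (q t)" t] mo that
      unfolding motion_on_def a_def b_def by (metis fst_conv, metis snd_conv)
  qed
  define h where "h = (\<lambda>t. ((a t)\<^sup>2 + (b t)\<^sup>2) / 2 + K\<^sup>2 / (2 * (r t)\<^sup>2) - \<rho> * ring_integral (r t) (z t))"
  have "(h has_real_derivative 0) (at t within ?I)" if I: "t \<in> ?I" for t
  proof -
    have r: "r t > 0" using dom[OF I] by (simp add: reduced_domain_def)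
    have cab: "continuous_on ?I a" "continuous_on ?I b"
      using DERIV_continuous_on[OF ab(1)] DERIV_continuous_on[OF ab(2)] by auto
    note J = ring_integral_has_derivative_along[OF _ I dom rz cab, simplified]
    have "((\<lambda>t. ((a t)\<^sup>2 + (b t)\<^sup>2) / 2) has_real_derivative a t * \<alpha> + b t * \<beta>) (at t within ?I)"
      if "(a has_real_derivative \<alpha>) (at t within ?I)" "(b has_real_derivative \<beta>) (at t within ?I)" for \<alpha> \<beta>
      by (auto intro!: derivative_eq_intros that simp: field_simps)
    note kin = this[OF ab[OF I]]
    have cen: "((\<lambda>t. K\<^sup>2 / (2 * (r t)\<^sup>2)) has_real_derivative - (a t * K\<^sup>2 / r t ^ 3)) (at t within ?I)"
      using r by (auto intro!: derivative_eq_intros rz[OF I] simp: divide_simps power_numeral_reduce)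
    show ?thesis unfolding h_def
      by (rule DERIV_cong[OF DERIV_diff[OF DERIV_add[OF kin cen] DERIV_cmult[OF J]]])
        (simp add: algebra_simps)
  qed
  then obtain c where "\<forall>t\<in>?I. h t = c"
    using has_field_derivative_zero_constant[of ?I h] by auto
  then have "h t = h 0" using t by auto
  then show ?thesis
    by (simp add: reduced_energy_def h_def r_def z_def a_def b_def case_prod_beta)
qed

text \<open>At radii beyond the critical one, the energy minus its value at the equilibrium splits into three
nonnegative parts: the kinetic energy, the gain \<open>W(r,z) - W(r,0)\<close> from leaving the plane, and
\<open>U(r) - U(p)\<close>. Away from the equilibrium at least one of them is positive.\<close>

lemma circular_orbit_stable:
  assumes "\<rho> > 0" and eq: "equilibrium reduced_domain (reduced_field \<rho> K) (p, 0)"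
    and p: "p > critical_radius \<rho>"
  shows "lyapunov_stable reduced_domain (reduced_field \<rho> K) (p, 0)"
proof -
  let ?U = "eff_potential \<rho> K" and ?H = "reduced_energy \<rho> K" and ?c = "critical_radius \<rho>"
  have c: "1 < ?c" and incr: "\<And>r s. ?c \<le> r \<Longrightarrow> r < s \<Longrightarrow> orbit_momentum2 r < orbit_momentum2 s"
    using critical_radius_turning_point[OF assms(1)] by auto
  have K: "K\<^sup>2 = \<rho> * orbit_momentum2 p" using reduced_equilibrium(3)[OF assms(1) eq] by simp
  have contU: "continuous_on {s..t} ?U" if "?c < s" for s t
    using that c by (intro continuous_at_imp_continuous_on ballI DERIV_isCont[OF eff_potential_has_derivative]) auto
  have Umin: "?U p < ?U r" if "?c < r" "r \<noteq> p" for r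
  proof (cases "r < p")
    case True
    show ?thesis
    proof (rule DERIV_neg_imp_decreasing_open[of r p ?U, OF True _ contU[OF that(1)]])
      fix s assume "r < s" "s < p"
      then show "\<exists>d. (?U has_real_derivative d) (at s) \<and> d < 0"
        using that c incr[of s p] assms(1)
        by (intro exI[of _ "(\<rho> * orbit_momentum2 s - K\<^sup>2) / s ^ 3"] conjI
            eff_potential_has_derivative divide_neg_pos) (auto simp: K)
    qed
  next
    case False
    then have "p < r" using that by simp
    then show ?thesis
    proof (rule DERIV_pos_imp_increasing_open[of p r ?U, OF _ _ contU[OF p]])
      fix s assume "p < s" "s < r"
      then show "\<exists>d. (?U has_real_derivative d) (at s) \<and> d > 0"
        using p c incr[of p s] assms(1)
        by (intro exI[of _ "(\<rho> * orbit_momentum2 s - K\<^sup>2) / s ^ 3"] conjI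
            eff_potential_has_derivative divide_pos_pos) (auto simp: K)
    qed
  qed
  have H: "?H ((r, z), (a, b)) = (a\<^sup>2 + b\<^sup>2) / 2 + \<rho> * (ring_integral r 0 - ring_integral r z) + ?U r" for r z a b
    by (simp add: reduced_energy_def eff_potential_def cyl_potential_eq algebra_simps)
  define R where "R = (p - ?c) / 2"
  have R: "R > 0" using p by (simp add: R_def)
  let ?B = "cball ((p, 0), 0) R :: ((real \<times> real) \<times> (real \<times> real)) set"
  have outside: "?c < fst (fst x)" if "x \<in> ?B" for x
  proof -
    have "dist (fst (fst x)) p \<le> dist x ((p, 0), 0)"
      using dist_fst_le[of "fst x" "(p, 0)"] dist_fst_le[of x "((p, 0), 0)"] by simp
    also have "\<dots> \<le> R" using that by (simp add: dist_commute)
    finally show ?thesis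
      using p abs_ge_minus_self[of "fst (fst x) - p"] unfolding R_def dist_real_def by argo
  qed
  show ?thesis
  proof (rule lyapunov_stable_of_first_integral[where H = ?H, OF eq R])
    have dom: "fst x \<in> reduced_domain" if "x \<in> ?B" for x
      using outside[OF that] c by (auto simp: reduced_domain_def case_prod_beta prod_eq_iff)
    have J: "continuous_on (?B) (\<lambda>x. ring_integral (fst (fst x)) (snd (fst x)))"
      using continuous_on_compose2[OF continuous_on_ring_integral, of "?B" fst] dom
      by (force simp: case_prod_beta intro: continuous_on_fst continuous_on_id)
    have "fst (fst x) \<noteq> 0" if "x \<in> ?B" for x
      using outside[OF that] c by auto
    then show "continuous_on (?B) ?H"
      unfolding reduced_energy_def case_prod_beta by (intro continuous_intros J) auto
    fix x assume x: "x \<in> ?B" "x \<noteq> ((p, 0), 0)"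
    obtain r z a b where xe: "x = ((r, z), (a, b))" by (metis surj_pair)
    have r: "?c < r" using outside[OF x(1)] xe by simp
    have kin: "(a\<^sup>2 + b\<^sup>2) / 2 \<ge> 0" "a \<noteq> 0 \<or> b \<noteq> 0 \<Longrightarrow> (a\<^sup>2 + b\<^sup>2) / 2 > 0"
      by (auto simp: sum_power2_gt_zero_iff)
    have ver: "\<rho> * (ring_integral r 0 - ring_integral r z) \<ge> 0"
      "z \<noteq> 0 \<Longrightarrow> \<rho> * (ring_integral r 0 - ring_integral r z) > 0"
      using ring_integral_less_in_plane[of r z] r c assms(1) by (cases "z = 0"; force)+
    have rad: "?U r \<ge> ?U p" "r \<noteq> p \<Longrightarrow> ?U r > ?U p"
      using Umin[OF r] by (cases "r = p"; force)+
    have "r \<noteq> p \<or> z \<noteq> 0 \<or> a \<noteq> 0 \<or> b \<noteq> 0" using x xe by (auto simp: zero_prod_def)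
    then have "?U p < ?H x" unfolding xe H using kin ver rad by linarith
    moreover have "?H ((p, 0), 0) = ?U p" by (simp add: zero_prod_def H)
    ultimately show "?H ((p, 0), 0) < ?H x" by simp
  qed (rule reduced_energy_conserved)
qed

text \<open>Up to the critical radius \<open>orbit_momentum2\<close> decreases, so for \<open>r < p\<close> it exceeds its value
\<open>K\<^sup>2/\<rho>\<close> at \<open>p\<close>, that is, the net radial force points inwards. Pushed inwards from \<open>p\<close> with any speed
\<open>w\<close>, however small, the particle reaches the point halfway between \<open>p\<close> and the ring.\<close>

lemma circular_orbit_unstable:
  assumes "\<rho> > 0" and eq: "equilibrium reduced_domain (reduced_field \<rho> K) (p, 0)"
    and p: "p \<le> critical_radius \<rho>"
  shows "\<not> lyapunov_stable reduced_domain (reduced_field \<rho> K) (p, 0)"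
proof
  assume stable: "lyapunov_stable reduced_domain (reduced_field \<rho> K) (p, 0)"
  let ?U = "eff_potential \<rho> K"
  define U' where "U' = (\<lambda>r. (\<rho> * orbit_momentum2 r - K\<^sup>2) / r ^ 3)"
  have U: "(?U has_real_derivative U' s) (at s)" if "s > 1" for s
    using eff_potential_has_derivative[OF that] by (simp add: U'_def)
  have p1: "1 < p" and K: "K\<^sup>2 = \<rho> * orbit_momentum2 p" using reduced_equilibrium[OF assms(1) eq] by simp_all
  have Umax: "?U s \<le> ?U p" if "1 < s" "s \<le> p" for s
  proof (rule DERIV_nonneg_imp_nondecreasing[of s p ?U, OF that(2)])
    fix x assume x: "s \<le> x" "x \<le> p"
    have "orbit_momentum2 p \<le> orbit_momentum2 x"
      using critical_radius_turning_point(2)[OF assms(1), of x p] x that p by (cases "x = p") auto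
    then have "U' x \<ge> 0" using x that assms(1) by (simp add: U'_def K)
    then show "\<exists>d. (?U has_real_derivative d) (at x) \<and> 0 \<le> d" using U[of x] x that by auto
  qed
  define c where "c = (1 + p) / 2"
  define \<epsilon> where "\<epsilon> = (p - c) / 2"
  have c: "1 < c" "c < p" and \<epsilon>: "\<epsilon> > 0" using p1 by (simp_all add: c_def \<epsilon>_def field_simps)
  obtain \<delta> where \<delta>: "\<delta> > 0" and confined: "\<And>T q v t. motion_on reduced_domain (reduced_field \<rho> K) {0..<T} q v \<Longrightarrow>
      dist (q 0, v 0) ((p, 0), 0) < \<delta> \<Longrightarrow> t \<in> {0..<T} \<Longrightarrow> dist (q t, v t) ((p, 0), 0) < \<epsilon>"
    using stable \<epsilon> unfolding lyapunov_stable_def by meson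
  define w where "w = \<delta> / 2"
  \<comment> \<open>the energy of the motion that starts at \<open>p\<close> with inward speed \<open>w\<close>\<close>
  define E where "E = ?U p + w\<^sup>2 / 2"
  have w: "0 < w" "w < \<delta>" using \<delta> by (simp_all add: w_def)
  \<comment> \<open>to the right of \<open>p\<close> the potential may rise; continuity keeps it below \<open>E\<close> for a short distance\<close>
  have "isCont ?U p" using U[OF p1] by (rule DERIV_isCont)
  then obtain d where d: "d > 0" "\<And>s. dist s p < d \<Longrightarrow> dist (?U s) (?U p) < w\<^sup>2 / 2"
    using w unfolding continuous_at_eps_delta by (metis half_gt_zero zero_less_power)
  have below_E: "?U s < E" if "s \<in> {(1 + c) / 2..p + d / 2}" for s
  proof (cases "s \<le> p")
    case True
    have "w\<^sup>2 > 0" using w by simp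
    moreover have "?U s \<le> ?U p" using True that c by (intro Umax) auto
    ultimately show ?thesis unfolding E_def by linarith
  next
    case False
    then have "dist (?U s) (?U p) < w\<^sup>2 / 2" using that d by (intro d) (auto simp: dist_real_def)
    then show ?thesis unfolding E_def dist_real_def by linarith
  qed
  obtain T y where T: "0 \<le> T" and y0: "y 0 = p" and yT: "y T = c"
    and yin: "\<And>t. t \<in> {0..T} \<Longrightarrow> y t \<in> {c..p}"
    and y': "\<And>t. t \<in> {0..T} \<Longrightarrow> (y has_real_derivative - sqrt (2 * (E - ?U (y t)))) (at t)"
  proof (rule conservative_motion_by_quadrature[of "(1 + c) / 2" c p "p + d / 2" ?U U' E])
    show "(?U has_real_derivative U' s) (at s)" if "s \<in> {(1 + c) / 2..p + d / 2}" for s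
      using that c by (intro U) auto
  qed (use c d below_E in auto)
  define q v where "q = (\<lambda>t. (y t, 0::real))" and "v = (\<lambda>t. (- sqrt (2 * (E - ?U (y t))), 0::real))"
  have "motion_on reduced_domain (reduced_field \<rho> K) {0..<T} q v"
    unfolding motion_on_def
  proof (intro ballI conjI)
    fix t assume "t \<in> {0..<T}"
    then have t: "t \<in> {0..T}" by auto
    have y1: "y t > 1" using yin[OF t] c by auto
    show dom: "q t \<in> reduced_domain" using y1 by (simp add: q_def reduced_domain_def)
    have pair: "((\<lambda>t. (f t, 0::real)) has_vector_derivative (f', 0)) (at t within S)"
      if "(f has_real_derivative f') (at t)" for f f' S
      using that by (intro has_vector_derivative_Pair has_vector_derivative_const)
        (auto simp: has_real_derivative_iff_has_vector_derivative intro: has_vector_derivative_at_within)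
    show "(q has_vector_derivative v t) (at t within {0..<T})"
      unfolding q_def v_def by (rule pair[OF y'[OF t]])
    have pos: "2 * (E - ?U (y t)) > 0" using below_E[of "y t"] yin[OF t] c d by auto
    have "((\<lambda>t. 2 * (E - ?U (y t))) has_real_derivative 2 * (0 - U' (y t) * - sqrt (2 * (E - ?U (y t))))) (at t)"
      by (intro DERIV_cmult DERIV_diff DERIV_const DERIV_chain2[OF U[OF y1] y'[OF t]])
    from DERIV_minus[OF DERIV_chain2[OF DERIV_real_sqrt[OF pos] this]]
    have "((\<lambda>t. - sqrt (2 * (E - ?U (y t)))) has_real_derivative - U' (y t)) (at t)"
      using pos by (simp add: field_simps)
    moreover have "reduced_field \<rho> K (q t) = (- U' (y t), 0)"
      using reduced_field_eq[of "y t" 0] dom y1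
      by (simp add: q_def U'_def vertical_pull_def orbit_momentum2_def diff_divide_distrib)
    ultimately show "(v has_vector_derivative reduced_field \<rho> K (q t)) (at t within {0..<T})"
      unfolding v_def by (simp add: pair)
  qed
  moreover have "dist (q 0, v 0) ((p, 0), 0) < \<delta>"
    using w by (simp add: q_def v_def y0 E_def dist_Pair_Pair zero_prod_def dist_real_def)
  ultimately have near: "dist (q t, v t) ((p, 0), 0) < \<epsilon>" if "t \<in> {0..<T}" for t
    using confined that by blast
  have "continuous_on {0..T} y"
    by (intro continuous_at_imp_continuous_on ballI DERIV_isCont[OF y'])
  \<comment> \<open>the motion is considered on \<open>[0, T)\<close>, which excludes the arrival at \<open>c\<close>; halfway is far enough\<close>
  then obtain t where t: "0 \<le> t" "t \<le> T" "y t = (p + c) / 2"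
    using IVT2'[of y T "(p + c) / 2" 0] y0 yT c T by auto
  then have "t \<in> {0..<T}" using yT c by (cases "t = T") auto
  from near[OF this] have "dist (q t) (p, 0) < \<epsilon>"
    using dist_fst_le[of "(q t, v t)" "((p, 0), 0)"] by simp
  then have "dist (y t) p < \<epsilon>"
    using dist_fst_le[of "q t" "(p, 0)"] by (simp add: q_def)
  then show False using t c by (simp add: \<epsilon>_def dist_real_def field_simps)
qed

theorem proposition3:
  fixes \<rho> :: real
  assumes "\<rho> > 0"
  shows "(\<forall>I x v r. circular_solution \<rho> I x v r \<longrightarrow> (\<forall>t\<in>I. x t $ 3 = 0)) \<and>
         (\<forall>I x v r. circular_solution \<rho> I x v r \<longrightarrow>
            (stable_circular_solution \<rho> I x v r \<longleftrightarrow> r > critical_radius \<rho>))"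
proof (intro conjI allI impI)
  fix I x v r
  assume "circular_solution \<rho> I x v r"
  then obtain K z where sol: "newton_solution \<rho> I x v"
    and orbit: "\<And>t. t \<in> I \<Longrightarrow> angular_momentum (x t) (v t) = K \<and> canonical_projection (x t) = (r, z)"
    and eq: "equilibrium reduced_domain (reduced_field \<rho> K) (r, z)"
    unfolding circular_solution_def by blast
  have z: "z = 0" by (rule reduced_equilibrium(1)[OF assms eq])
  then show "\<forall>t\<in>I. x t $ 3 = 0" using orbit by (auto simp: canonical_projection_def)
  show "stable_circular_solution \<rho> I x v r \<longleftrightarrow> r > critical_radius \<rho>"
  proof
    assume "r > critical_radius \<rho>"
    then have "lyapunov_stable reduced_domain (reduced_field \<rho> K) (r, z)"
      using circular_orbit_stable assms eq z by blast
    then show "stable_circular_solution \<rho> I x v r"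
      unfolding stable_circular_solution_def using sol orbit by blast
  next
    assume "stable_circular_solution \<rho> I x v r"
    then obtain K' z' where st: "lyapunov_stable reduced_domain (reduced_field \<rho> K') (r, z')"
      unfolding stable_circular_solution_def by blast
    then have eq': "equilibrium reduced_domain (reduced_field \<rho> K') (r, z')"
      by (simp add: lyapunov_stable_def)
    then have "z' = 0" by (rule reduced_equilibrium(1)[OF assms])
    then show "r > critical_radius \<rho>"
      using circular_orbit_unstable[OF assms] eq' st by force
  qed
qed

end
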